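(* For every formula $\varphi\in\mathcal{L}_{\Box\Diamond}$: $\models_{\Pi\mathcal{G}}\varphi$ if and only if $\vdash_{K45(\mathbf{G})}\varphi$. That is, $\varphi$ is valid in all possibilistic Gödel Kripke models if and only if $\varphi$ is a theorem of $K45(\mathbf{G})$.
   Context: Language. Fix a countable set $Var$ of propositional variables. $\mathcal{L}_{\Box\Diamond}$ is the set of formulas built from $Var$ and the constant $\bot$ with the binary connectives $\wedge,\to$ and the unary operators $\Box,\Diamond$. Abbreviations: $\top := \bot\to\bot$, $\neg\varphi := \varphi\to\bot$, $\varphi\vee\psi := ((\varphi\to\psi)\to\psi)\wedge((\psi\to\varphi)\to\varphi)$. Calculus. Gödel propositional logic $G$ has modus ponens as its rule and the axiom schemes: $(\varphi\to\psi)\to((\psi\to\chi)\to(\varphi\to\chi))$; $(\varphi\wedge\psi)\to\varphi$; $(\varphi\wedge\psi)\to(\psi\wedge\varphi)$; $(\varphi\to(\psi\to\chi))\to((\varphi\wedge\psi)\to\chi)$; $((\varphi\wedge\psi)\to\chi)\to(\varphi\to(\psi\to\chi))$; $\varphi\to(\varphi\wedge\varphi)$; $((\varphi\to\psi)\to\chi)\to(((\psi\to\varphi)\to\chi)\to\chi)$; $\bot\to\varphi$. The logic $K(\mathbf{G})$ consists of $G$ over the modal language together with the axiom schemes $\Box(\varphi\to\psi)\to(\Box\varphi\to\Box\psi)$; $\Diamond(\varphi\vee\psi)\to(\Diamond\varphi\vee\Diamond\psi)$; $\Box\top$; $\neg\Diamond\bot$; $\Box(\varphi\to\psi)\to(\Diamond\varphi\to\Diamond\psi)$;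 $(\Diamond\varphi\to\Box\psi)\to\Box(\varphi\to\psi)$; and the rule (Nec): from $\varphi$ infer $\Box\varphi$. The logic $K45(\mathbf{G})$ is $K(\mathbf{G})$ plus the axiom schemes $\Box\varphi\to\Box\Box\varphi$; $\Diamond\Diamond\varphi\to\Diamond\varphi$; $\Diamond\Box\varphi\to\Box\varphi$; $\Diamond\varphi\to\Box\Diamond\varphi$. $\vdash_{K45(\mathbf{G})}\varphi$ means that $\varphi$ is a theorem (derivable without assumptions). Semantics. On $[0,1]$ let $x\Rightarrow y = 1$ if $x\le y$ and $x\Rightarrow y=y$ otherwise. A possibilistic Gödel Kripke model ($\Pi G$-model) is a triple $\langle W,\pi,e\rangle$ with $W$ a non-empty set, $\pi:W\to[0,1]$ and $e:W\times Var\to[0,1]$ arbitrary maps. $e$ is extended to all formulas by $e(w,\bot)=0$, $e(w,\varphi\wedge\psi)=\min(e(w,\varphi),e(w,\psi))$, $e(w,\varphi\to\psi)=e(w,\varphi)\Rightarrow e(w,\psi)$, $e(w,\Box\varphi)=\inf_{w'\in W}\{\pi(w')\Rightarrow e(w',\varphi)\}$, $e(w,\Diamond\varphi)=\sup_{w'\in W}\{\min(\pi(w'),e(w',\varphi))\}$. $\varphi$ is valid in the model if $e(w,\varphi)=1$ for all $w\in W$. $\models_{\Pi\mathcal{G}}\varphi$ means $\varphi$ is valid in every $\Pi G$-model. *)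

theory Defs
  imports Complex_Main "HOL-Library.Countable"
begin

section \<open>Language\<close>

datatype 'v fm =
    Var 'v
  | Bot                  ("\<^bold>\<bottom>")
  | Conj "'v fm" "'v fm" (infixr "\<^bold>\<and>" 65)
  | Imp "'v fm" "'v fm"  (infixr "\<^bold>\<rightarrow>" 55)
  | Box "'v fm"          ("\<box>_" [80] 80)
  | Dia "'v fm"          ("\<diamond>_" [80] 80)

abbreviation Top :: "'v fm" ("\<^bold>\<top>") where
  "\<^bold>\<top> \<equiv> \<^bold>\<bottom> \<^bold>\<rightarrow> \<^bold>\<bottom>"

abbreviation Neg :: "'v fm \<Rightarrow> 'v fm" ("\<^bold>\<not>_" [80] 80) where
  "\<^bold>\<not>\<phi> \<equiv> \<phi> \<^bold>\<rightarrow> \<^bold>\<bottom>"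

abbreviation Disj :: "'v fm \<Rightarrow> 'v fm \<Rightarrow> 'v fm" (infixr "\<^bold>\<or>" 60) where
  "\<phi> \<^bold>\<or> \<psi> \<equiv> ((\<phi> \<^bold>\<rightarrow> \<psi>) \<^bold>\<rightarrow> \<psi>) \<^bold>\<and> ((\<psi> \<^bold>\<rightarrow> \<phi>) \<^bold>\<rightarrow> \<phi>)"

section \<open>Calculus\<close>

inductive G_axiom :: "'v fm \<Rightarrow> bool" where
  G1: "G_axiom ((\<phi> \<^bold>\<rightarrow> \<psi>) \<^bold>\<rightarrow> ((\<psi> \<^bold>\<rightarrow> \<chi>) \<^bold>\<rightarrow> (\<phi> \<^bold>\<rightarrow> \<chi>)))"
| G2: "G_axiom ((\<phi> \<^bold>\<and> \<psi>) \<^bold>\<rightarrow> \<phi>)"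
| G3: "G_axiom ((\<phi> \<^bold>\<and> \<psi>) \<^bold>\<rightarrow> (\<psi> \<^bold>\<and> \<phi>))"
| G4: "G_axiom ((\<phi> \<^bold>\<rightarrow> (\<psi> \<^bold>\<rightarrow> \<chi>)) \<^bold>\<rightarrow> ((\<phi> \<^bold>\<and> \<psi>) \<^bold>\<rightarrow> \<chi>))"
| G5: "G_axiom (((\<phi> \<^bold>\<and> \<psi>) \<^bold>\<rightarrow> \<chi>) \<^bold>\<rightarrow> (\<phi> \<^bold>\<rightarrow> (\<psi> \<^bold>\<rightarrow> \<chi>)))"
| G6: "G_axiom (\<phi> \<^bold>\<rightarrow> (\<phi> \<^bold>\<and> \<phi>))"
| G7: "G_axiom (((\<phi> \<^bold>\<rightarrow> \<psi>) \<^bold>\<rightarrow> \<chi>) \<^bold>\<rightarrow> (((\<psi> \<^bold>\<rightarrow> \<phi>) \<^bold>\<rightarrow> \<chi>) \<^bold>\<rightarrow> \<chi>))"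
| G8: "G_axiom (\<^bold>\<bottom> \<^bold>\<rightarrow> \<phi>)"

inductive KG_axiom :: "'v fm \<Rightarrow> bool" where
  G: "G_axiom \<phi> \<Longrightarrow> KG_axiom \<phi>"
| K_Box: "KG_axiom (\<box>(\<phi> \<^bold>\<rightarrow> \<psi>) \<^bold>\<rightarrow> (\<box>\<phi> \<^bold>\<rightarrow> \<box>\<psi>))"
| K_Dia: "KG_axiom (\<diamond>(\<phi> \<^bold>\<or> \<psi>) \<^bold>\<rightarrow> (\<diamond>\<phi> \<^bold>\<or> \<diamond>\<psi>))"
| F_Box: "KG_axiom (\<box>\<^bold>\<top>)"
| F_Dia: "KG_axiom (\<^bold>\<not>\<diamond>\<^bold>\<bottom>)"
| P: "KG_axiom (\<box>(\<phi> \<^bold>\<rightarrow> \<psi>) \<^bold>\<rightarrow> (\<diamond>\<phi> \<^bold>\<rightarrow> \<diamond>\<psi>))"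
| FS2: "KG_axiom ((\<diamond>\<phi> \<^bold>\<rightarrow> \<box>\<psi>) \<^bold>\<rightarrow> \<box>(\<phi> \<^bold>\<rightarrow> \<psi>))"

inductive K45G_axiom :: "'v fm \<Rightarrow> bool" where
  KG: "KG_axiom \<phi> \<Longrightarrow> K45G_axiom \<phi>"
| Four_Box: "K45G_axiom (\<box>\<phi> \<^bold>\<rightarrow> \<box>\<box>\<phi>)"
| Four_Dia: "K45G_axiom (\<diamond>\<diamond>\<phi> \<^bold>\<rightarrow> \<diamond>\<phi>)"
| Five_Box: "K45G_axiom (\<diamond>\<box>\<phi> \<^bold>\<rightarrow> \<box>\<phi>)"
| Five_Dia: "K45G_axiom (\<diamond>\<phi> \<^bold>\<rightarrow> \<box>\<diamond>\<phi>)"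

inductive K45G_theorem :: "'v fm \<Rightarrow> bool" ("\<turnstile>\<^sub>K\<^sub>4\<^sub>5\<^sub>G _" [50] 50) where
  Ax: "K45G_axiom \<phi> \<Longrightarrow> \<turnstile>\<^sub>K\<^sub>4\<^sub>5\<^sub>G \<phi>"
| MP: "\<turnstile>\<^sub>K\<^sub>4\<^sub>5\<^sub>G \<phi> \<^bold>\<rightarrow> \<psi> \<Longrightarrow> \<turnstile>\<^sub>K\<^sub>4\<^sub>5\<^sub>G \<phi> \<Longrightarrow> \<turnstile>\<^sub>K\<^sub>4\<^sub>5\<^sub>G \<psi>"
| Nec: "\<turnstile>\<^sub>K\<^sub>4\<^sub>5\<^sub>G \<phi> \<Longrightarrow> \<turnstile>\<^sub>K\<^sub>4\<^sub>5\<^sub>G \<box>\<phi>"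

section \<open>Possibilistic semantics\<close>

definition godel_imp :: "real \<Rightarrow> real \<Rightarrow> real" (infixr "\<Rightarrow>\<^sub>G" 60) where
  "x \<Rightarrow>\<^sub>G y = (if x \<le> y then 1 else y)"

text \<open>Truth degrees are reals; only the values of the maps on the carrier \<open>W\<close> are
  constrained to the unit interval, and only those are ever used.\<close>

definition PiG_model :: "'w set \<Rightarrow> ('w \<Rightarrow> real) \<Rightarrow> ('w \<Rightarrow> 'v \<Rightarrow> real) \<Rightarrow> bool" where
  "PiG_model W \<pi> e \<longleftrightarrow>
     W \<noteq> {} \<and> (\<forall>w\<in>W. \<pi> w \<in> {0..1}) \<and> (\<forall>w\<in>W. \<forall>p. e w p \<in> {0..1})"

primrec eval :: "'w set \<Rightarrow> ('w \<Rightarrow> real) \<Rightarrow> ('w \<Rightarrow> 'v \<Rightarrow> real) \<Rightarrow> 'w \<Rightarrow> 'v fm \<Rightarrow> real" where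
  "eval W \<pi> e w (Var p) = e w p"
| "eval W \<pi> e w \<^bold>\<bottom> = 0"
| "eval W \<pi> e w (\<phi> \<^bold>\<and> \<psi>) = min (eval W \<pi> e w \<phi>) (eval W \<pi> e w \<psi>)"
| "eval W \<pi> e w (\<phi> \<^bold>\<rightarrow> \<psi>) = (eval W \<pi> e w \<phi> \<Rightarrow>\<^sub>G eval W \<pi> e w \<psi>)"
| "eval W \<pi> e w (\<box>\<phi>) = (INF w'\<in>W. \<pi> w' \<Rightarrow>\<^sub>G eval W \<pi> e w' \<phi>)"
| "eval W \<pi> e w (\<diamond>\<phi>) = (SUP w'\<in>W. min (\<pi> w') (eval W \<pi> e w' \<phi>))"

text \<open>Infima and suprema of reals are unspecified on empty or unbounded sets; by the
  following fact this never happens in a model.\<close>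

lemma eval_in_unit_interval:
  assumes "PiG_model W \<pi> e" and "w \<in> W"
  shows "eval W \<pi> e w \<phi> \<in> {0..1}"
  using assms(2)
proof (induction \<phi> arbitrary: w)
  case (Box \<phi>)
  have W: "W \<noteq> {}" using assms(1) by (simp add: PiG_model_def)
  have *: "0 \<le> (\<pi> v \<Rightarrow>\<^sub>G eval W \<pi> e v \<phi>) \<and> (\<pi> v \<Rightarrow>\<^sub>G eval W \<pi> e v \<phi>) \<le> 1" if "v \<in> W" for v
    using Box.IH[OF that] by (auto simp: godel_imp_def)
  have "bdd_below ((\<lambda>v. \<pi> v \<Rightarrow>\<^sub>G eval W \<pi> e v \<phi>) ` W)"
    using * by (intro bdd_belowI[of _ 0]) auto
  then have "(INF v\<in>W. \<pi> v \<Rightarrow>\<^sub>G eval W \<pi> e v \<phi>) \<le> 1"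
    using * Box.prems by (meson cINF_lower2)
  moreover have "0 \<le> (INF v\<in>W. \<pi> v \<Rightarrow>\<^sub>G eval W \<pi> e v \<phi>)"
    using * W by (intro cINF_greatest) auto
  ultimately show ?case by simp
next
  case (Dia \<phi>)
  have W: "W \<noteq> {}" using assms(1) by (simp add: PiG_model_def)
  have *: "0 \<le> min (\<pi> v) (eval W \<pi> e v \<phi>) \<and> min (\<pi> v) (eval W \<pi> e v \<phi>) \<le> 1"
    if "v \<in> W" for v
    using Dia.IH[OF that] assms(1) that by (auto simp: PiG_model_def)
  have "bdd_above ((\<lambda>v. min (\<pi> v) (eval W \<pi> e v \<phi>)) ` W)"
    using * by (intro bdd_aboveI[of _ 1]) auto
  then have "0 \<le> (SUP v\<in>W. min (\<pi> v) (eval W \<pi> e v \<phi>))"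
    using * Dia.prems by (meson cSUP_upper2)
  moreover have "(SUP v\<in>W. min (\<pi> v) (eval W \<pi> e v \<phi>)) \<le> 1"
    using * W by (intro cSUP_least) auto
  ultimately show ?case by simp
qed (use assms(1) in \<open>auto simp: PiG_model_def godel_imp_def min_def\<close>)

definition valid_in :: "'w set \<Rightarrow> ('w \<Rightarrow> real) \<Rightarrow> ('w \<Rightarrow> 'v \<Rightarrow> real) \<Rightarrow> 'v fm \<Rightarrow> bool" where
  "valid_in W \<pi> e \<phi> \<longleftrightarrow> (\<forall>w\<in>W. eval W \<pi> e w \<phi> = 1)"

text \<open>HOL cannot quantify over types inside a formula, so the class of all models is
  relative to a universe type \<open>'w\<close> whose nonempty subsets (of any size) serve as sets of
  worlds.  The universe has to be infinite for completeness: for instance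
  \<open>\<box>\<^bold>\<not>\<^bold>\<not>p \<^bold>\<rightarrow> \<^bold>\<not>\<^bold>\<not>\<box>p\<close> holds in all finite models but not in all models.  Every model
  can be transported to a sufficiently large infinite universe.\<close>

definition PiG_valid :: "'w itself \<Rightarrow> 'v fm \<Rightarrow> bool" where
  "PiG_valid _ \<phi> \<longleftrightarrow>
     (\<forall>(W :: 'w set) \<pi> e. PiG_model W \<pi> e \<longrightarrow> valid_in W \<pi> e \<phi>)"

end

theory Submission
  imports Defs "HOL-Library.Countable_Set"
begin

text \<open>For completeness, a non-theorem \<open>\<phi>\<close> is avoided by some linear theory \<open>T\<close>; ranks in
  the finite set \<open>S\<close> of subformulas turn \<open>T\<close> into real values \<open>v\<close>.  Every world of the countermodel
  agrees with \<open>v\<close> on modal formulas.  For a modal formula \<open>e\<close> outside \<open>T\<close>, the set of all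
  \<open>\<chi>\<close> with \<open>\<box>\<chi>\<close> strictly above \<open>e\<close> in \<open>T\<close> is a theory that contains
  \<open>\<box>\<chi> \<^bold>\<rightarrow> \<chi>\<close> and \<open>\<chi> \<^bold>\<rightarrow> \<diamond>\<chi>\<close>. A linear extension \<open>U\<close> of it that avoids \<open>e\<close>
  contains exactly the modal formulas above \<open>e\<close> and orders the others as \<open>T\<close> does, so it
  becomes a world whose possibility degree is a threshold just above \<open>v e\<close>.  Such worlds
  attain \<open>\<diamond>\<theta>\<close>, and approximate \<open>\<box>\<theta>\<close> up to \<open>1 / (n + 1)\<close> for every \<open>n\<close>; hence
  countably many of them suffice.\<close>

section \<open>Soundness\<close>

text \<open>Residuation for the minimum. The bound on \<open>c\<close> covers the case
  \<open>x \<le> y\<close>, where the implication takes the value 1. In this way the modal axioms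
  become inequalities between minima.\<close>

lemma le_godel_imp_iff:
  assumes "c \<le> 1" shows "c \<le> (x \<Rightarrow>\<^sub>G y) \<longleftrightarrow> min c x \<le> y"
  using assms by (auto simp: godel_imp_def min_def)

lemma godel_imp_eq_1_iff:
  assumes "x \<le> 1" shows "(x \<Rightarrow>\<^sub>G y) = 1 \<longleftrightarrow> x \<le> y"
  using assms by (auto simp: godel_imp_def)

context
  fixes W :: "'w set" and \<pi> :: "'w \<Rightarrow> real" and e :: "'w \<Rightarrow> 'v \<Rightarrow> real"
  assumes model: "PiG_model W \<pi> e"
begin

lemma eval_nonneg: "w \<in> W \<Longrightarrow> 0 \<le> eval W \<pi> e w \<phi>"
  and eval_le_1: "w \<in> W \<Longrightarrow> eval W \<pi> e w \<phi> \<le> 1"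
  using eval_in_unit_interval[OF model] by auto

lemma poss_le_1: "w \<in> W \<Longrightarrow> \<pi> w \<le> 1"
  using model by (auto simp: PiG_model_def)

lemma eval_Imp_eq_1: "w \<in> W \<Longrightarrow>
  eval W \<pi> e w (\<phi> \<^bold>\<rightarrow> \<psi>) = 1 \<longleftrightarrow> eval W \<pi> e w \<phi> \<le> eval W \<pi> e w \<psi>"
  using eval_le_1 by (simp add: godel_imp_eq_1_iff)

lemma eval_Box_lower:
  assumes "w \<in> W" shows "eval W \<pi> e v (\<box>\<phi>) \<le> (\<pi> w \<Rightarrow>\<^sub>G eval W \<pi> e w \<phi>)"
proof -
  have "bdd_below ((\<lambda>w. \<pi> w \<Rightarrow>\<^sub>G eval W \<pi> e w \<phi>) ` W)"
    using eval_nonneg by (intro bdd_belowI[of _ 0]) (auto simp: godel_imp_def)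
  then show ?thesis using assms by (auto intro: cINF_lower)
qed

lemma eval_Dia_upper:
  assumes "w \<in> W" shows "min (\<pi> w) (eval W \<pi> e w \<phi>) \<le> eval W \<pi> e v (\<diamond>\<phi>)"
proof -
  have "bdd_above ((\<lambda>w. min (\<pi> w) (eval W \<pi> e w \<phi>)) ` W)"
    using eval_le_1 by (intro bdd_aboveI[of _ 1]) (auto simp: min_le_iff_disj)
  then show ?thesis using assms by (auto intro: cSUP_upper)
qed

text \<open>The universal property of the infimum combined with residuation, so that boxes can be
  compared world by world. The world \<open>v\<close> is absent from the right-hand side because
  possibility depends only on the target world.\<close>

lemma le_eval_Box_iff:
  assumes "c \<le> 1"
  shows "c \<le> eval W \<pi> e v (\<box>\<phi>) \<longleftrightarrow> (\<forall>w\<in>W. min c (\<pi> w) \<le> eval W \<pi> e w \<phi>)"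
    (is "?l \<longleftrightarrow> ?r")
proof
  assume ?l
  then show ?r using eval_Box_lower le_godel_imp_iff[OF assms] by (meson order_trans)
next
  assume ?r
  then have "\<forall>w\<in>W. c \<le> (\<pi> w \<Rightarrow>\<^sub>G eval W \<pi> e w \<phi>)" using le_godel_imp_iff[OF assms] by blast
  moreover have "W \<noteq> {}" using model by (simp add: PiG_model_def)
  ultimately show ?l by (auto intro: cINF_greatest)
qed

lemma eval_Dia_le_iff:
  "eval W \<pi> e v (\<diamond>\<phi>) \<le> c \<longleftrightarrow> (\<forall>w\<in>W. min (\<pi> w) (eval W \<pi> e w \<phi>) \<le> c)" (is "?l \<longleftrightarrow> ?r")
proof
  assume ?l
  then show ?r using eval_Dia_upper by (meson order_trans)
next
  assume ?r
  moreover have "W \<noteq> {}" using model by (simp add: PiG_model_def)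
  ultimately show ?l by (auto intro: cSUP_least)
qed

lemma eval_Disj:
  assumes "w \<in> W"
  shows "eval W \<pi> e w (\<phi> \<^bold>\<or> \<psi>) = max (eval W \<pi> e w \<phi>) (eval W \<pi> e w \<psi>)"
  using eval_le_1[OF assms, of \<phi>] eval_le_1[OF assms, of \<psi>]
  by (auto simp: godel_imp_def min_def max_def)

lemma min_eval_Box_le:
  "w \<in> W \<Longrightarrow> min (eval W \<pi> e v (\<box>\<phi>)) (\<pi> w) \<le> eval W \<pi> e w \<phi>" if "v \<in> W"
  using le_eval_Box_iff[OF eval_le_1[OF that]] by blast

lemma min_eval_Box_Imp_le:
  assumes "v \<in> W" and "w \<in> W"
  shows "min (min (eval W \<pi> e v (\<box>(\<phi> \<^bold>\<rightarrow> \<psi>))) (\<pi> w)) (eval W \<pi> e w \<phi>) \<le> eval W \<pi> e w \<psi>"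
proof -
  have "min (eval W \<pi> e v (\<box>(\<phi> \<^bold>\<rightarrow> \<psi>))) (\<pi> w) \<le> 1" using poss_le_1[OF assms(2)] by linarith
  then show ?thesis using min_eval_Box_le[OF assms, of "\<phi> \<^bold>\<rightarrow> \<psi>"] le_godel_imp_iff
    by (metis eval.simps(4))
qed

section \<open>Validity of the axioms and rules\<close>

lemma sound_G: "G_axiom \<phi> \<Longrightarrow> w \<in> W \<Longrightarrow> eval W \<pi> e w \<phi> = 1"
proof (induction rule: G_axiom.induct)
  case (G7 \<phi> \<psi> \<chi>)
  then show ?case
    using eval_le_1[of w \<phi>] eval_le_1[of w \<psi>] eval_le_1[of w \<chi>]
    by (auto simp: godel_imp_def)
next
  case (G8 \<phi>)
  then show ?case using eval_nonneg[of w \<phi>] by (simp add: godel_imp_def)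
qed (auto simp: godel_imp_def min_def)

lemma sound_KG: "KG_axiom \<phi> \<Longrightarrow> w \<in> W \<Longrightarrow> eval W \<pi> e w \<phi> = 1"
proof (induction rule: KG_axiom.induct)
  case (G \<phi>)
  then show ?case by (rule sound_G)
next
  case (K_Box \<phi> \<psi>)
  let ?a = "eval W \<pi> e w (\<box>(\<phi> \<^bold>\<rightarrow> \<psi>))" and ?b = "eval W \<pi> e w (\<box>\<phi>)"
  have "min ?a ?b \<le> eval W \<pi> e w (\<box>\<psi>)"
  proof (subst le_eval_Box_iff; safe?)
    show "min ?a ?b \<le> 1" using eval_le_1[OF K_Box, of "\<box>\<phi>"] by linarith
    fix x assume x: "x \<in> W"
    have "min (min ?a (\<pi> x)) (eval W \<pi> e x \<phi>) \<le> eval W \<pi> e x \<psi>"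
      using min_eval_Box_Imp_le[OF K_Box x] .
    moreover have "min ?b (\<pi> x) \<le> eval W \<pi> e x \<phi>" using min_eval_Box_le[OF K_Box x] .
    ultimately show "min (min ?a ?b) (\<pi> x) \<le> eval W \<pi> e x \<psi>" by linarith
  qed
  then show ?case using K_Box eval_le_1[OF K_Box] eval_Imp_eq_1
    by (metis eval.simps(4) le_godel_imp_iff)
next
  case (K_Dia \<phi> \<psi>)
  have "eval W \<pi> e w (\<diamond>(\<phi> \<^bold>\<or> \<psi>)) \<le> eval W \<pi> e w (\<diamond>\<phi> \<^bold>\<or> \<diamond>\<psi>)"
    unfolding eval_Dia_le_iff
  proof
    fix x assume x: "x \<in> W"
    show "min (\<pi> x) (eval W \<pi> e x (\<phi> \<^bold>\<or> \<psi>)) \<le> eval W \<pi> e w (\<diamond>\<phi> \<^bold>\<or> \<diamond>\<psi>)"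
      using eval_Dia_upper[OF x, of \<phi> w] eval_Dia_upper[OF x, of \<psi> w]
      unfolding eval_Disj[OF x] eval_Disj[OF K_Dia] by linarith
  qed
  then show ?case using eval_Imp_eq_1[OF K_Dia] by blast
next
  case F_Box
  have "1 \<le> eval W \<pi> e w (\<box>\<^bold>\<top>)"
    by (subst le_eval_Box_iff) (auto simp: godel_imp_def)
  then show ?case using eval_le_1[OF F_Box, of "\<box>\<^bold>\<top>"] by linarith
next
  case F_Dia
  have "eval W \<pi> e w (\<diamond>\<^bold>\<bottom>) \<le> eval W \<pi> e w \<^bold>\<bottom>"
    unfolding eval_Dia_le_iff by simp
  then show ?case using eval_Imp_eq_1[OF F_Dia] by blast
next
  case (P \<phi> \<psi>)
  let ?a = "eval W \<pi> e w (\<box>(\<phi> \<^bold>\<rightarrow> \<psi>))"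
  have "?a \<le> (eval W \<pi> e w (\<diamond>\<phi>) \<Rightarrow>\<^sub>G eval W \<pi> e w (\<diamond>\<psi>))"
  \<comment> \<open>If residuation failed, \<open>?a\<close> would exceed the value of
    \<open>\<diamond>\<psi>\<close> and drop out of the minimum at every world, which bounds
    \<open>\<diamond>\<phi>\<close> by \<open>\<diamond>\<psi>\<close>.\<close>
  proof (rule ccontr)
    assume "\<not> ?thesis"
    then have "\<not> min ?a (eval W \<pi> e w (\<diamond>\<phi>)) \<le> eval W \<pi> e w (\<diamond>\<psi>)"
      using le_godel_imp_iff[OF eval_le_1[OF P]] by blast
    then have lt: "eval W \<pi> e w (\<diamond>\<psi>) < ?a" "eval W \<pi> e w (\<diamond>\<psi>) < eval W \<pi> e w (\<diamond>\<phi>)"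
      by linarith+
    have "eval W \<pi> e w (\<diamond>\<phi>) \<le> eval W \<pi> e w (\<diamond>\<psi>)"
      unfolding eval_Dia_le_iff[of w \<phi>]
    proof
      fix x assume x: "x \<in> W"
      have "min (min ?a (\<pi> x)) (eval W \<pi> e x \<phi>) \<le> eval W \<pi> e x \<psi>"
        using min_eval_Box_Imp_le[OF P x] .
      then show "min (\<pi> x) (eval W \<pi> e x \<phi>) \<le> eval W \<pi> e w (\<diamond>\<psi>)"
        using eval_Dia_upper[OF x, of \<psi> w] lt(1) by linarith
    qed
    then show False using lt(2) by linarith
  qed
  then show ?case using eval_Imp_eq_1[OF P] by (metis eval.simps(4))
next
  case (FS2 \<phi> \<psi>)
  let ?a = "eval W \<pi> e w (\<diamond>\<phi> \<^bold>\<rightarrow> \<box>\<psi>)"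
  have a1: "?a \<le> 1" using eval_le_1[OF FS2] .
  \<comment> \<open>Residuation of a reflexive inequality, that is, modus ponens inside the
    algebra.\<close>
  have a: "min ?a (eval W \<pi> e w (\<diamond>\<phi>)) \<le> eval W \<pi> e w (\<box>\<psi>)"
    using le_godel_imp_iff[OF a1] by (metis eval.simps(4) order_refl)
  have "?a \<le> eval W \<pi> e w (\<box>(\<phi> \<^bold>\<rightarrow> \<psi>))"
    unfolding le_eval_Box_iff[OF a1]
  proof
    fix x assume x: "x \<in> W"
    have "min (min ?a (\<pi> x)) (eval W \<pi> e x \<phi>) \<le> eval W \<pi> e x \<psi>"
      using a min_eval_Box_le[OF FS2 x, of \<psi>] eval_Dia_upper[OF x, of \<phi> w] by linarith
    then show "min ?a (\<pi> x) \<le> eval W \<pi> e x (\<phi> \<^bold>\<rightarrow> \<psi>)"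
      using poss_le_1[OF x] by (simp only: eval.simps(4), subst le_godel_imp_iff) auto
  qed
  then show ?case using eval_Imp_eq_1[OF FS2] by blast
qed

text \<open>Possibility is attached to single worlds, not to pairs of worlds, so modal values are
  global. The four introspection axioms reduce to this.\<close>

lemma eval_Box_const: "eval W \<pi> e v (\<box>\<phi>) = eval W \<pi> e w (\<box>\<phi>)"
  and eval_Dia_const: "eval W \<pi> e v (\<diamond>\<phi>) = eval W \<pi> e w (\<diamond>\<phi>)"
  by simp_all

lemma sound_K45G: "K45G_axiom \<phi> \<Longrightarrow> w \<in> W \<Longrightarrow> eval W \<pi> e w \<phi> = 1"
proof (induction rule: K45G_axiom.induct)
  case (KG \<phi>)
  then show ?case by (rule sound_KG)
next
  case (Four_Box \<phi>)
  have "eval W \<pi> e w (\<box>\<phi>) \<le> eval W \<pi> e w (\<box>\<box>\<phi>)"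
    unfolding le_eval_Box_iff[OF eval_le_1[OF Four_Box]]
  proof
    fix x show "min (eval W \<pi> e w (\<box>\<phi>)) (\<pi> x) \<le> eval W \<pi> e x (\<box>\<phi>)" using eval_Box_const[of x \<phi> w] by linarith
  qed
  then show ?case using eval_Imp_eq_1[OF Four_Box] by blast
next
  case (Four_Dia \<phi>)
  have "eval W \<pi> e w (\<diamond>\<diamond>\<phi>) \<le> eval W \<pi> e w (\<diamond>\<phi>)"
    unfolding eval_Dia_le_iff[of w "\<diamond>\<phi>"]
  proof
    fix x show "min (\<pi> x) (eval W \<pi> e x (\<diamond>\<phi>)) \<le> eval W \<pi> e w (\<diamond>\<phi>)" using eval_Dia_const[of x \<phi> w] by linarith
  qed
  then show ?case using eval_Imp_eq_1[OF Four_Dia] by blast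
next
  case (Five_Box \<phi>)
  have "eval W \<pi> e w (\<diamond>\<box>\<phi>) \<le> eval W \<pi> e w (\<box>\<phi>)"
    unfolding eval_Dia_le_iff[of w "\<box>\<phi>"]
  proof
    fix x show "min (\<pi> x) (eval W \<pi> e x (\<box>\<phi>)) \<le> eval W \<pi> e w (\<box>\<phi>)" using eval_Box_const[of x \<phi> w] by linarith
  qed
  then show ?case using eval_Imp_eq_1[OF Five_Box] by blast
next
  case (Five_Dia \<phi>)
  have "eval W \<pi> e w (\<diamond>\<phi>) \<le> eval W \<pi> e w (\<box>\<diamond>\<phi>)"
    unfolding le_eval_Box_iff[OF eval_le_1[OF Five_Dia]]
  proof
    fix x show "min (eval W \<pi> e w (\<diamond>\<phi>)) (\<pi> x) \<le> eval W \<pi> e x (\<diamond>\<phi>)" using eval_Dia_const[of x \<phi> w] by linarith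
  qed
  then show ?case using eval_Imp_eq_1[OF Five_Dia] by blast
qed

lemma soundness: "\<turnstile>\<^sub>K\<^sub>4\<^sub>5\<^sub>G \<phi> \<Longrightarrow> w \<in> W \<Longrightarrow> eval W \<pi> e w \<phi> = 1"
proof (induction arbitrary: w rule: K45G_theorem.induct)
  case (Ax \<phi>)
  then show ?case by (rule sound_K45G)
next
  case (MP \<phi> \<psi>)
  then show ?case using eval_Imp_eq_1 eval_le_1 by (metis order_antisym)
next
  case (Nec \<phi>)
  have "1 \<le> eval W \<pi> e w (\<box>\<phi>)"
    by (subst le_eval_Box_iff) (auto simp: Nec.IH)
  then show ?case using eval_le_1[OF Nec.prems, of "\<box>\<phi>"] by linarith
qed

end

section \<open>Linear theories\<close>

text \<open>Closure under necessitation is left out: with it, the deduction theorem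
  \<open>is_theory_extend\<close> would fail.\<close>

definition is_theory :: "'v fm set \<Rightarrow> bool" where
  "is_theory T \<longleftrightarrow> (\<forall>\<chi>. \<turnstile>\<^sub>K\<^sub>4\<^sub>5\<^sub>G \<chi> \<longrightarrow> \<chi> \<in> T) \<and>
     (\<forall>\<chi> \<psi>. \<chi> \<^bold>\<rightarrow> \<psi> \<in> T \<longrightarrow> \<chi> \<in> T \<longrightarrow> \<psi> \<in> T)"

text \<open>The formulas modulo equivalence in \<open>T\<close> then form a Goedel chain whose top
  class is \<open>T\<close>.\<close>

definition linear_theory :: "'v fm set \<Rightarrow> bool" where
  "linear_theory T \<longleftrightarrow> is_theory T \<and> (\<forall>\<chi> \<psi>. \<chi> \<^bold>\<rightarrow> \<psi> \<in> T \<or> \<psi> \<^bold>\<rightarrow> \<chi> \<in> T)"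

lemma theory_thm: "is_theory T \<Longrightarrow> \<turnstile>\<^sub>K\<^sub>4\<^sub>5\<^sub>G \<chi> \<Longrightarrow> \<chi> \<in> T"
  by (simp add: is_theory_def)

lemma theory_mp: "is_theory T \<Longrightarrow> \<chi> \<^bold>\<rightarrow> \<psi> \<in> T \<Longrightarrow> \<chi> \<in> T \<Longrightarrow> \<psi> \<in> T"
  by (auto simp: is_theory_def)

lemma is_theory_theorems: "is_theory {\<chi>. \<turnstile>\<^sub>K\<^sub>4\<^sub>5\<^sub>G \<chi>}"
  by (auto simp: is_theory_def intro: MP)

section \<open>Propositional reasoning inside a theory\<close>

lemma thm_G: "G_axiom \<chi> \<Longrightarrow> \<turnstile>\<^sub>K\<^sub>4\<^sub>5\<^sub>G \<chi>" and thm_KG: "KG_axiom \<chi> \<Longrightarrow> \<turnstile>\<^sub>K\<^sub>4\<^sub>5\<^sub>G \<chi>"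
  by (auto intro: Ax KG KG_axiom.G)

lemma thm_K: "\<turnstile>\<^sub>K\<^sub>4\<^sub>5\<^sub>G \<phi> \<^bold>\<rightarrow> \<psi> \<^bold>\<rightarrow> \<phi>"
  using MP[OF thm_G[OF G5] thm_G[OF G2]] .

lemma thm_trans: "\<turnstile>\<^sub>K\<^sub>4\<^sub>5\<^sub>G \<phi> \<^bold>\<rightarrow> \<psi> \<Longrightarrow> \<turnstile>\<^sub>K\<^sub>4\<^sub>5\<^sub>G \<psi> \<^bold>\<rightarrow> \<chi> \<Longrightarrow> \<turnstile>\<^sub>K\<^sub>4\<^sub>5\<^sub>G \<phi> \<^bold>\<rightarrow> \<chi>"
  by (meson G1 MP thm_G)

lemma thm_refl: "\<turnstile>\<^sub>K\<^sub>4\<^sub>5\<^sub>G \<phi> \<^bold>\<rightarrow> \<phi>"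
  using thm_trans[OF thm_G[OF G6] thm_G[OF G2]] .

context
  fixes T :: "'v fm set"
  assumes T: "is_theory T"
begin

lemma theory_refl: "\<chi> \<^bold>\<rightarrow> \<chi> \<in> T"
  using theory_thm[OF T thm_refl] .

lemma theory_weaken: "\<chi> \<in> T \<Longrightarrow> \<psi> \<^bold>\<rightarrow> \<chi> \<in> T"
  using theory_mp[OF T theory_thm[OF T thm_K]] .

lemma theory_trans: "\<phi> \<^bold>\<rightarrow> \<psi> \<in> T \<Longrightarrow> \<psi> \<^bold>\<rightarrow> \<chi> \<in> T \<Longrightarrow> \<phi> \<^bold>\<rightarrow> \<chi> \<in> T"
  using theory_mp[OF T theory_mp[OF T theory_thm[OF T thm_G[OF G1]]]] .

text \<open>Exchange comes from the commutativity of conjunction, contraction from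
  \<open>G6\<close>. This is the modus ponens case of the deduction theorem.\<close>

lemma theory_imp_mp:
  assumes "\<phi> \<^bold>\<rightarrow> \<psi> \<^bold>\<rightarrow> \<chi> \<in> T" and "\<phi> \<^bold>\<rightarrow> \<psi> \<in> T"
  shows "\<phi> \<^bold>\<rightarrow> \<chi> \<in> T"
proof -
  have "\<phi> \<^bold>\<and> \<psi> \<^bold>\<rightarrow> \<chi> \<in> T" using theory_mp[OF T theory_thm[OF T thm_G[OF G4]] assms(1)] .
  then have "\<psi> \<^bold>\<and> \<phi> \<^bold>\<rightarrow> \<chi> \<in> T" using theory_trans[OF theory_thm[OF T thm_G[OF G3]]] by blast
  then have "\<psi> \<^bold>\<rightarrow> \<phi> \<^bold>\<rightarrow> \<chi> \<in> T" using theory_mp[OF T theory_thm[OF T thm_G[OF G5]]] by blast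
  then have "\<phi> \<^bold>\<rightarrow> \<phi> \<^bold>\<rightarrow> \<chi> \<in> T" using theory_trans[OF assms(2)] by blast
  then have "\<phi> \<^bold>\<and> \<phi> \<^bold>\<rightarrow> \<chi> \<in> T" using theory_mp[OF T theory_thm[OF T thm_G[OF G4]]] by blast
  then show ?thesis using theory_trans[OF theory_thm[OF T thm_G[OF G6]]] by blast
qed

text \<open>The deduction theorem: this set is the theory generated by \<open>T\<close> and
  \<open>\<alpha>\<close>.\<close>

lemma is_theory_extend: "is_theory {\<chi>. \<alpha> \<^bold>\<rightarrow> \<chi> \<in> T}"
  unfolding is_theory_def using theory_weaken[OF theory_thm[OF T]] theory_imp_mp by blast

lemma theory_Conj_iff: "\<phi> \<^bold>\<and> \<psi> \<in> T \<longleftrightarrow> \<phi> \<in> T \<and> \<psi> \<in> T"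
proof
  assume a: "\<phi> \<^bold>\<and> \<psi> \<in> T"
  then have "\<psi> \<^bold>\<and> \<phi> \<in> T" using theory_mp[OF T theory_thm[OF T thm_G[OF G3]]] by blast
  then show "\<phi> \<in> T \<and> \<psi> \<in> T" using a theory_mp[OF T theory_thm[OF T thm_G[OF G2]]] by blast
next
  assume a: "\<phi> \<in> T \<and> \<psi> \<in> T"
  have "\<phi> \<^bold>\<rightarrow> \<psi> \<^bold>\<rightarrow> \<phi> \<^bold>\<and> \<psi> \<in> T"
    using theory_mp[OF T theory_thm[OF T thm_G[OF G5]] theory_refl] .
  then show "\<phi> \<^bold>\<and> \<psi> \<in> T" using a theory_mp[OF T] by blast
qed

end

text \<open>For the converse, take as \<open>T\<close> the consequences of \<open>\<phi>\<close>.
  Derivations can thus be replaced by membership arguments in an arbitrary theory.\<close>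

lemma thm_Imp_iff: "\<turnstile>\<^sub>K\<^sub>4\<^sub>5\<^sub>G \<phi> \<^bold>\<rightarrow> \<psi> \<longleftrightarrow> (\<forall>T. is_theory T \<longrightarrow> \<phi> \<in> T \<longrightarrow> \<psi> \<in> T)"
proof
  assume "\<turnstile>\<^sub>K\<^sub>4\<^sub>5\<^sub>G \<phi> \<^bold>\<rightarrow> \<psi>"
  then show "\<forall>T. is_theory T \<longrightarrow> \<phi> \<in> T \<longrightarrow> \<psi> \<in> T" using theory_mp theory_thm by blast
next
  assume "\<forall>T. is_theory T \<longrightarrow> \<phi> \<in> T \<longrightarrow> \<psi> \<in> T"
  then show "\<turnstile>\<^sub>K\<^sub>4\<^sub>5\<^sub>G \<phi> \<^bold>\<rightarrow> \<psi>"
    using is_theory_extend[OF is_theory_theorems, of \<phi>] thm_refl by auto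
qed

lemma theory_Imp_Conj_iff:
  assumes "is_theory T"
  shows "\<alpha> \<^bold>\<rightarrow> \<phi> \<^bold>\<and> \<psi> \<in> T \<longleftrightarrow> \<alpha> \<^bold>\<rightarrow> \<phi> \<in> T \<and> \<alpha> \<^bold>\<rightarrow> \<psi> \<in> T"
  using theory_Conj_iff[OF is_theory_extend[OF assms]] by simp

text \<open>Zorn's lemma gives a theory \<open>U\<close> that is maximal among those containing
  \<open>T\<close> and avoiding \<open>e\<close>. Every formula outside \<open>U\<close> implies
  \<open>e\<close> in \<open>U\<close>, since adding it must produce \<open>e\<close>. If both
  implications between two formulas were missing, \<open>G7\<close> would put \<open>e\<close> into
  \<open>U\<close>.\<close>

lemma linear_extension:
  assumes T: "is_theory T" and e: "e \<notin> T"
  obtains U where "linear_theory U" "T \<subseteq> U" "e \<notin> U"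
proof -
  let ?A = "{U. is_theory U \<and> T \<subseteq> U \<and> e \<notin> U}"
  have "\<exists>U\<in>?A. \<forall>X\<in>?A. U \<subseteq> X \<longrightarrow> X = U"
  proof (rule subset_Zorn_nonempty)
    show "?A \<noteq> {}" using T e by blast
  next
    fix C assume C: "C \<noteq> {}" "subset.chain ?A C"
    then have CA: "C \<subseteq> ?A" and lin: "\<And>X Y. X \<in> C \<Longrightarrow> Y \<in> C \<Longrightarrow> X \<subseteq> Y \<or> Y \<subseteq> X"
      by (auto simp: subset_chain_def)
    have "\<psi> \<in> \<Union>C" if h: "\<chi> \<^bold>\<rightarrow> \<psi> \<in> \<Union>C" "\<chi> \<in> \<Union>C" for \<chi> \<psi>
    proof -
      obtain X Y where XY: "X \<in> C" "Y \<in> C" "\<chi> \<^bold>\<rightarrow> \<psi> \<in> X" "\<chi> \<in> Y" using h by blast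
      then obtain Z where Z: "Z \<in> C" "\<chi> \<^bold>\<rightarrow> \<psi> \<in> Z" "\<chi> \<in> Z" using lin by blast
      then have "is_theory Z" using CA by blast
      then show ?thesis using Z theory_mp by blast
    qed
    then have mp: "\<forall>\<chi> \<psi>. \<chi> \<^bold>\<rightarrow> \<psi> \<in> \<Union>C \<longrightarrow> \<chi> \<in> \<Union>C \<longrightarrow> \<psi> \<in> \<Union>C" by iprover
    have "\<chi> \<in> \<Union>C" if "\<turnstile>\<^sub>K\<^sub>4\<^sub>5\<^sub>G \<chi>" for \<chi>
      using C(1) CA that theory_thm by blast
    then have "is_theory (\<Union>C)" unfolding is_theory_def using mp by iprover
    then show "\<Union>C \<in> ?A" using C(1) CA by blast
  qed
  then obtain U where UA: "U \<in> ?A" and max: "\<forall>X\<in>?A. U \<subseteq> X \<longrightarrow> X = U" by (rule bexE)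
  have U: "is_theory U" "T \<subseteq> U" "e \<notin> U" using UA by simp_all
  have mx: "X = U" if "is_theory X" "T \<subseteq> X" "e \<notin> X" "U \<subseteq> X" for X
    using bspec[OF max, of X] that by simp
  have ext: "\<alpha> \<^bold>\<rightarrow> e \<in> U" if "\<alpha> \<notin> U" for \<alpha>
  proof (rule ccontr)
    assume "\<alpha> \<^bold>\<rightarrow> e \<notin> U"
    moreover have "U \<subseteq> {\<chi>. \<alpha> \<^bold>\<rightarrow> \<chi> \<in> U}" using theory_weaken[OF U(1)] by blast
    ultimately have "{\<chi>. \<alpha> \<^bold>\<rightarrow> \<chi> \<in> U} = U"
      using U(2) by (intro mx is_theory_extend[OF U(1)]) auto
    then show False using theory_refl[OF U(1), of \<alpha>] that by blast
  qed
  have "\<chi> \<^bold>\<rightarrow> \<psi> \<in> U \<or> \<psi> \<^bold>\<rightarrow> \<chi> \<in> U" for \<chi> \<psi>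
  proof (rule ccontr)
    assume "\<not> ?thesis"
    then have "(\<chi> \<^bold>\<rightarrow> \<psi>) \<^bold>\<rightarrow> e \<in> U" "(\<psi> \<^bold>\<rightarrow> \<chi>) \<^bold>\<rightarrow> e \<in> U" using ext by blast+
    then have "e \<in> U" using theory_mp[OF U(1)] theory_thm[OF U(1) thm_G[OF G7]] by blast
    then show False using U(3) by blast
  qed
  then have "linear_theory U" unfolding linear_theory_def using U(1) by iprover
  then show thesis using that U by iprover
qed

context
  fixes U :: "'v fm set"
  assumes U: "linear_theory U"
begin

lemma linear_is_theory: "is_theory U"
  using U by (simp add: linear_theory_def)

lemma linear_total: "\<chi> \<^bold>\<rightarrow> \<psi> \<notin> U \<Longrightarrow> \<psi> \<^bold>\<rightarrow> \<chi> \<in> U"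
  using U by (auto simp: linear_theory_def)

text \<open>In a chain, an implication below the top equals its conclusion. By contraction
  \<open>\<chi> \<rightarrow> (\<chi> \<rightarrow> \<psi>)\<close> is missing as well, so linearity
  lets \<open>\<chi> \<rightarrow> \<psi>\<close> imply \<open>\<chi>\<close>, and hence
  \<open>\<psi>\<close>.\<close>

lemma linear_residuum: "\<chi> \<^bold>\<rightarrow> \<psi> \<notin> U \<Longrightarrow> (\<chi> \<^bold>\<rightarrow> \<psi>) \<^bold>\<rightarrow> \<psi> \<in> U"
  using linear_total[of \<chi> "\<chi> \<^bold>\<rightarrow> \<psi>"] theory_imp_mp[OF linear_is_theory]
    theory_refl[OF linear_is_theory] by blast

end

section \<open>Modal formulas and the theories of accessible worlds\<close>

text \<open>A syntactic counterpart of having the same value in all worlds. Being defined by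
  provability and not by the outermost connective, it is closed under implication.\<close>

definition modal :: "'v fm \<Rightarrow> bool" where
  "modal m \<longleftrightarrow> \<turnstile>\<^sub>K\<^sub>4\<^sub>5\<^sub>G m \<^bold>\<rightarrow> \<box>m \<and> \<turnstile>\<^sub>K\<^sub>4\<^sub>5\<^sub>G \<diamond>m \<^bold>\<rightarrow> m"

lemma modal_Bot: "modal \<^bold>\<bottom>"
  using thm_G[OF G8] thm_KG[OF F_Dia] by (auto simp: modal_def)

lemma modal_Box: "modal (\<box>\<chi>)" and modal_Dia: "modal (\<diamond>\<chi>)"
  by (auto simp: modal_def intro: Ax Four_Box Four_Dia Five_Box Five_Dia)

text \<open>First half: \<open>a \<rightarrow> b\<close> gives
  \<open>\<diamond>a \<rightarrow> \<box>b\<close>, the premise of \<open>FS2\<close>. Second half: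
  boxing \<open>a \<rightarrow> (a \<rightarrow> b) \<rightarrow> b\<close> and applying
  \<open>K_Box\<close> and \<open>P\<close> gives \<open>\<box>a \<rightarrow> \<diamond>(a
  \<rightarrow> b) \<rightarrow> \<diamond>b\<close>, where \<open>\<box>a\<close> and
  \<open>\<diamond>b\<close> are replaced by \<open>a\<close> and \<open>b\<close>.\<close>

lemma modal_Imp:
  assumes a: "modal a" and b: "modal b" shows "modal (a \<^bold>\<rightarrow> b)"
  unfolding modal_def thm_Imp_iff
proof (intro conjI allI impI)
  fix T :: "'a fm set" assume T: "is_theory T"
  have th: "\<turnstile>\<^sub>K\<^sub>4\<^sub>5\<^sub>G \<chi> \<Longrightarrow> \<chi> \<in> T" for \<chi> using theory_thm[OF T] .
  note tr = theory_trans[OF T]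
  {
    assume "a \<^bold>\<rightarrow> b \<in> T"
    then have "\<diamond>a \<^bold>\<rightarrow> \<box>b \<in> T" using a b th tr by (meson modal_def)
    then show "\<box>(a \<^bold>\<rightarrow> b) \<in> T" using theory_mp[OF T th[OF thm_KG[OF FS2]]] by blast
  next
    assume d: "\<diamond>(a \<^bold>\<rightarrow> b) \<in> T"
    have "\<turnstile>\<^sub>K\<^sub>4\<^sub>5\<^sub>G a \<^bold>\<rightarrow> (a \<^bold>\<rightarrow> b) \<^bold>\<rightarrow> b"
      unfolding thm_Imp_iff
    proof (intro allI impI)
      fix T :: "'a fm set" assume "is_theory T" "a \<in> T"
      then show "(a \<^bold>\<rightarrow> b) \<^bold>\<rightarrow> b \<in> T"
        using theory_imp_mp theory_refl theory_weaken by blast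
    qed
    then have "\<box>a \<^bold>\<rightarrow> \<box>((a \<^bold>\<rightarrow> b) \<^bold>\<rightarrow> b) \<in> T" using MP[OF thm_KG[OF K_Box]] Nec th by blast
    then have "\<box>a \<^bold>\<rightarrow> \<diamond>(a \<^bold>\<rightarrow> b) \<^bold>\<rightarrow> \<diamond>b \<in> T" using tr th[OF thm_KG[OF P]] by blast
    then have "\<box>a \<^bold>\<rightarrow> \<diamond>b \<in> T" using theory_imp_mp[OF T] theory_weaken[OF T d] by blast
    then show "a \<^bold>\<rightarrow> b \<in> T" using a b th tr by (meson modal_def)
  }
qed

section \<open>Theories cut off at a modal formula\<close>

definition above :: "'v fm set \<Rightarrow> 'v fm \<Rightarrow> 'v fm set" where
  "above T e = {\<chi>. \<box>\<chi> \<^bold>\<rightarrow> e \<notin> T}"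

definition accessible :: "'v fm set \<Rightarrow> 'v fm \<Rightarrow> 'v fm set \<Rightarrow> bool" where
  "accessible T e U \<longleftrightarrow> linear_theory U \<and> above T e \<subseteq> U \<and> e \<notin> U"

text \<open>Reflexivity fails in worlds of possibility 0, but its boxed form is derivable:
  \<open>Five_Box\<close> is the premise of an instance of \<open>FS2\<close>.\<close>

lemma thm_Box_T: "\<turnstile>\<^sub>K\<^sub>4\<^sub>5\<^sub>G \<box>(\<box>\<chi> \<^bold>\<rightarrow> \<chi>)"
  using MP[OF thm_KG[OF FS2] Ax[OF Five_Box]] .

lemma thm_Box_T_Dia: "\<turnstile>\<^sub>K\<^sub>4\<^sub>5\<^sub>G \<box>(\<chi> \<^bold>\<rightarrow> \<diamond>\<chi>)"
  using MP[OF thm_KG[OF FS2] Ax[OF Five_Dia]] .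

context
  fixes T :: "'v fm set" and e :: "'v fm"
  assumes T: "linear_theory T" and e: "e \<notin> T"
begin

private lemmas T_above = linear_is_theory[OF T]

lemma in_aboveI: "\<box>\<chi> \<in> T \<Longrightarrow> \<chi> \<in> above T e"
  using e theory_mp[OF T_above] by (auto simp: above_def)

lemma modal_in_aboveI:
  assumes "modal m" "m \<^bold>\<rightarrow> e \<notin> T" shows "m \<in> above T e"
proof -
  have "m \<^bold>\<rightarrow> \<box>m \<in> T" using assms(1) theory_thm[OF T_above] by (auto simp: modal_def)
  then show ?thesis using assms(2) theory_trans[OF T_above] by (auto simp: above_def)
qed

lemma modal_mem_aboveI: "modal m \<Longrightarrow> m \<in> T \<Longrightarrow> m \<in> above T e"
  using modal_in_aboveI theory_mp[OF T_above] e by blast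

text \<open>For modus ponens, the smaller of the two boxes
  \<open>\<box>(\<chi> \<rightarrow> \<psi>)\<close> and \<open>\<box>\<chi>\<close> implies the
  other, and so \<open>\<box>\<psi>\<close> by \<open>K_Box\<close>. If \<open>\<box>\<psi>\<close>
  were at most \<open>e\<close>, so would be that smaller box.\<close>

lemma is_theory_above: "is_theory (above T e)"
  unfolding is_theory_def
proof (intro conjI allI impI)
  fix \<chi> :: "'v fm" assume "\<turnstile>\<^sub>K\<^sub>4\<^sub>5\<^sub>G \<chi>"
  then show "\<chi> \<in> above T e" using in_aboveI theory_thm[OF T_above] Nec by blast
next
  fix \<chi> \<psi> :: "'v fm" assume a: "\<chi> \<^bold>\<rightarrow> \<psi> \<in> above T e" and b: "\<chi> \<in> above T e"
  show "\<psi> \<in> above T e"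
  proof (rule ccontr)
    assume "\<psi> \<notin> above T e"
    then have p: "\<box>\<psi> \<^bold>\<rightarrow> e \<in> T" by (simp add: above_def)
    have k: "\<box>(\<chi> \<^bold>\<rightarrow> \<psi>) \<^bold>\<rightarrow> \<box>\<chi> \<^bold>\<rightarrow> \<box>\<psi> \<in> T" using theory_thm[OF T_above thm_KG[OF K_Box]] .
    show False
    proof (cases "\<box>(\<chi> \<^bold>\<rightarrow> \<psi>) \<^bold>\<rightarrow> \<box>\<chi> \<in> T")
      case True
      then show False using theory_trans[OF T_above theory_imp_mp[OF T_above k] p] a by (simp add: above_def)
    next
      case False
      then have "\<box>\<chi> \<^bold>\<rightarrow> \<box>\<chi> \<^bold>\<rightarrow> \<box>\<psi> \<in> T" using theory_trans[OF T_above linear_total[OF T] k] by blast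
      then show False
        using theory_trans[OF T_above theory_imp_mp[OF T_above _ theory_refl[OF T_above]] p] b by (simp add: above_def)
    qed
  qed
qed

text \<open>If \<open>T\<close> contained \<open>m \<rightarrow> e\<close>, this modal formula would
  pass to \<open>U\<close>, and with \<open>m\<close> in \<open>U\<close> also \<open>e\<close>.
  Hence \<open>T\<close> and \<open>e\<close> alone determine the modal part of
  \<open>U\<close>.\<close>

lemma accessible_modal_iff:
  assumes U: "accessible T e U" and em: "modal e" and m: "modal m"
  shows "m \<in> U \<longleftrightarrow> m \<^bold>\<rightarrow> e \<notin> T"
proof
  assume "m \<in> U"
  then show "m \<^bold>\<rightarrow> e \<notin> T"
    using U modal_mem_aboveI[OF modal_Imp[OF m em]] theory_mp[OF linear_is_theory, of U m e]
    by (auto simp: accessible_def)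
next
  assume "m \<^bold>\<rightarrow> e \<notin> T"
  then show "m \<in> U" using modal_in_aboveI[OF m] U by (auto simp: accessible_def)
qed

text \<open>Below the cut, \<open>U\<close> inherits the order of \<open>T\<close>: if
  \<open>T\<close> lacks the implication, it has \<open>(a \<rightarrow> b) \<rightarrow> b\<close>,
  which is modal and passes to \<open>U\<close>. For \<open>b\<close> in \<open>U\<close> the order
  is lost, since all members of \<open>U\<close> are equivalent there.\<close>

lemma accessible_modal_Imp_iff:
  assumes U: "accessible T e U" and a: "modal a" and b: "modal b" "b \<notin> U"
  shows "a \<^bold>\<rightarrow> b \<in> U \<longleftrightarrow> a \<^bold>\<rightarrow> b \<in> T"
proof
  assume *: "a \<^bold>\<rightarrow> b \<in> U"
  show "a \<^bold>\<rightarrow> b \<in> T"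
  proof (rule ccontr)
    assume "a \<^bold>\<rightarrow> b \<notin> T"
    then have "(a \<^bold>\<rightarrow> b) \<^bold>\<rightarrow> b \<in> T" using linear_residuum[OF T] by blast
    then have "(a \<^bold>\<rightarrow> b) \<^bold>\<rightarrow> b \<in> U"
      using modal_mem_aboveI modal_Imp[OF modal_Imp[OF a b(1)] b(1)] U by (auto simp: accessible_def)
    then show False using * b(2) U theory_mp[OF linear_is_theory] by (auto simp: accessible_def)
  qed
next
  assume "a \<^bold>\<rightarrow> b \<in> T"
  then show "a \<^bold>\<rightarrow> b \<in> U"
    using modal_mem_aboveI modal_Imp[OF a b(1)] U by (auto simp: accessible_def)
qed

lemma accessible_Box: "accessible T e U \<Longrightarrow> \<box>\<chi> \<^bold>\<rightarrow> \<chi> \<in> U"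
  and accessible_Dia: "accessible T e U \<Longrightarrow> \<chi> \<^bold>\<rightarrow> \<diamond>\<chi> \<in> U"
  using in_aboveI[OF theory_thm[OF T_above thm_Box_T]] in_aboveI[OF theory_thm[OF T_above thm_Box_T_Dia]]
  unfolding accessible_def by blast+

text \<open>Adding \<open>\<theta>\<close> must not produce \<open>e\<close>. Otherwise
  \<open>\<box>(\<theta> \<rightarrow> e)\<close> would lie strictly above \<open>e\<close>, yet by
  \<open>P\<close> it implies \<open>\<diamond>\<theta> \<rightarrow> e\<close>, which collapses to
  \<open>e\<close> because \<open>\<diamond>\<theta>\<close> is above \<open>e\<close>.\<close>

lemma accessible_extend_Dia:
  assumes em: "modal e" and d: "\<diamond>\<theta> \<^bold>\<rightarrow> e \<notin> T"
  obtains U where "accessible T e U" "\<theta> \<in> U"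
proof -
  let ?A = "{\<chi>. \<theta> \<^bold>\<rightarrow> \<chi> \<in> above T e}"
  have "e \<notin> ?A"
  proof
    assume "e \<in> ?A"
    then have n: "\<box>(\<theta> \<^bold>\<rightarrow> e) \<^bold>\<rightarrow> e \<notin> T" by (simp add: above_def)
    have "(\<diamond>\<theta> \<^bold>\<rightarrow> e) \<^bold>\<rightarrow> e \<in> T" using linear_residuum[OF T d] .
    moreover have "\<box>(\<theta> \<^bold>\<rightarrow> e) \<^bold>\<rightarrow> \<diamond>\<theta> \<^bold>\<rightarrow> e \<in> T"
    proof -
      have "\<turnstile>\<^sub>K\<^sub>4\<^sub>5\<^sub>G \<diamond>e \<^bold>\<rightarrow> e" using em by (simp add: modal_def)
      then have "\<turnstile>\<^sub>K\<^sub>4\<^sub>5\<^sub>G (\<diamond>\<theta> \<^bold>\<rightarrow> \<diamond>e) \<^bold>\<rightarrow> \<diamond>\<theta> \<^bold>\<rightarrow> e"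
        unfolding thm_Imp_iff[of "\<diamond>\<theta> \<^bold>\<rightarrow> \<diamond>e"] using theory_thm theory_trans by blast
      then show ?thesis using thm_trans[OF thm_KG[OF P]] theory_thm[OF T_above] by blast
    qed
    ultimately show False using n theory_trans[OF T_above] by blast
  qed
  then obtain U where U: "linear_theory U" "?A \<subseteq> U" "e \<notin> U"
    using linear_extension[OF is_theory_extend[OF is_theory_above]] by blast
  have "above T e \<subseteq> ?A" using theory_weaken[OF is_theory_above] by blast
  moreover have "\<theta> \<in> U" using U(2) theory_refl[OF is_theory_above] by blast
  ultimately show thesis using that U by (auto simp: accessible_def)
qed

end

text \<open>The cut is at \<open>\<box>\<theta>\<close> itself, but the extension is chosen to avoid
  \<open>\<theta>\<close>. It then avoids \<open>\<box>\<theta>\<close> too, as it contains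
  \<open>\<box>\<theta> \<rightarrow> \<theta>\<close>.\<close>

lemma accessible_extend_Box:
  assumes T: "linear_theory T" and n: "\<box>\<theta> \<notin> T"
  obtains U where "accessible T (\<box>\<theta>) U" "\<theta> \<notin> U"
proof -
  have "\<theta> \<notin> above T (\<box>\<theta>)" using theory_refl[OF linear_is_theory[OF T]] by (simp add: above_def)
  then obtain U where U: "linear_theory U" "above T (\<box>\<theta>) \<subseteq> U" "\<theta> \<notin> U"
    using linear_extension[OF is_theory_above[OF T n]] by blast
  have "\<box>\<theta> \<^bold>\<rightarrow> \<theta> \<in> U"
    using U(2) in_aboveI[OF T n] theory_thm[OF linear_is_theory[OF T] thm_Box_T] by blast
  then have "\<box>\<theta> \<notin> U" using U theory_mp[OF linear_is_theory] by blast
  then show thesis using that U by (auto simp: accessible_def)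
qed

section \<open>From linear theories to real-valued worlds\<close>

text \<open>The set counted consists of the elements of \<open>S\<close> strictly below
  \<open>\<chi>\<close>. The denominator exceeds \<open>card S\<close> so that formulas outside
  \<open>T\<close> stay a full gap below 1.\<close>

definition rank :: "'v fm set \<Rightarrow> 'v fm set \<Rightarrow> 'v fm \<Rightarrow> real" where
  "rank S T \<chi> = (if \<chi> \<in> T then 1 else card {\<psi>\<in>S. \<chi> \<^bold>\<rightarrow> \<psi> \<notin> T} / (real (card S) + 1))"

lemma rank_nonneg: "0 \<le> rank S T \<chi>"
  by (simp add: rank_def)

lemma rank_eq_1: "\<chi> \<in> T \<Longrightarrow> rank S T \<chi> = 1"
  by (simp add: rank_def)

context
  fixes S T :: "'v fm set"
  assumes fin: "finite S" and T: "linear_theory T"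
begin

private lemmas T_rank = linear_is_theory[OF T]

lemma rank_le_gap:
  assumes "\<chi> \<notin> T" shows "rank S T \<chi> + 1 / (real (card S) + 1) \<le> 1"
proof -
  have "card {\<psi>\<in>S. \<chi> \<^bold>\<rightarrow> \<psi> \<notin> T} \<le> card S" using fin by (auto intro: card_mono)
  then show ?thesis using assms by (simp add: rank_def field_simps)
qed

private lemma gap_pos: "0 < 1 / (real (card S) + 1)"
  by simp

lemma rank_less_1: "\<chi> \<notin> T \<Longrightarrow> rank S T \<chi> < 1"
  using rank_le_gap[of \<chi>] gap_pos by linarith

lemma rank_le_1: "rank S T \<chi> \<le> 1"
  using rank_less_1[of \<chi>] by (cases "\<chi> \<in> T") (auto simp: rank_def)

lemma rank_Bot: "\<^bold>\<bottom> \<notin> T \<Longrightarrow> rank S T \<^bold>\<bottom> = 0"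
  using theory_thm[OF T_rank thm_G[OF G8]] by (simp add: rank_def)

lemma rank_mono:
  assumes "\<chi> \<^bold>\<rightarrow> \<psi> \<in> T" shows "rank S T \<chi> \<le> rank S T \<psi>"
proof (cases "\<psi> \<in> T")
  case True
  then show ?thesis using rank_le_1 by (simp add: rank_eq_1)
next
  case False
  then have "\<chi> \<notin> T" using assms theory_mp[OF T_rank] by blast
  moreover have "card {x\<in>S. \<chi> \<^bold>\<rightarrow> x \<notin> T} \<le> card {x\<in>S. \<psi> \<^bold>\<rightarrow> x \<notin> T}"
    using fin theory_trans[OF T_rank assms] by (intro card_mono) auto
  ultimately show ?thesis using False by (simp add: rank_def divide_right_mono)
qed

text \<open>The formula \<open>\<psi>\<close> is counted for \<open>\<chi>\<close> but not for
  itself. This is why it has to lie in \<open>S\<close>, while \<open>\<chi>\<close> is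
  arbitrary.\<close>

lemma rank_less:
  assumes "\<chi> \<^bold>\<rightarrow> \<psi> \<notin> T" and "\<psi> \<in> S"
  shows "rank S T \<psi> + 1 / (real (card S) + 1) \<le> rank S T \<chi>"
proof -
  have psi: "\<psi> \<notin> T" using assms(1) theory_weaken[OF T_rank] by blast
  show ?thesis
  proof (cases "\<chi> \<in> T")
    case True
    then show ?thesis using rank_le_gap[OF psi] by (simp add: rank_eq_1)
  next
    case False
    have "{x\<in>S. \<psi> \<^bold>\<rightarrow> x \<notin> T} \<subset> {x\<in>S. \<chi> \<^bold>\<rightarrow> x \<notin> T}"
      using theory_trans[OF T_rank _ linear_total[OF T]] theory_refl[OF T_rank] assms by blast
    then have "card {x\<in>S. \<psi> \<^bold>\<rightarrow> x \<notin> T} + 1 \<le> card {x\<in>S. \<chi> \<^bold>\<rightarrow> x \<notin> T}"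
      using fin by (metis (no_types, lifting) Suc_eq_plus1 Suc_leI finite_Collect_conjI finite_subset
          mem_Collect_eq psubset_card_mono subsetI)
    then have "real (card {x\<in>S. \<psi> \<^bold>\<rightarrow> x \<notin> T}) + 1 \<le> real (card {x\<in>S. \<chi> \<^bold>\<rightarrow> x \<notin> T})"
      by linarith
    then show ?thesis using False psi
      by (simp add: rank_def add_divide_distrib[symmetric] divide_right_mono)
  qed
qed

lemma rank_le_iff: "\<psi> \<in> S \<Longrightarrow> rank S T \<chi> \<le> rank S T \<psi> \<longleftrightarrow> \<chi> \<^bold>\<rightarrow> \<psi> \<in> T"
  using rank_mono[of \<chi> \<psi>] rank_less[of \<chi> \<psi>] gap_pos by linarith

end

text \<open>A formula strictly between two consecutive elements of \<open>M\<close> is placed just above the lower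
  one; taking the maximum over all elements of \<open>M\<close> below \<open>\<chi>\<close> makes strict monotonicity
  immediate.\<close>

definition spread ::
  "'v fm set \<Rightarrow> 'v fm set \<Rightarrow> 'v fm set \<Rightarrow> ('v fm \<Rightarrow> real) \<Rightarrow> real \<Rightarrow> 'v fm \<Rightarrow> real" where
  "spread S U M v \<epsilon> \<chi> =
     Max ((\<lambda>m. v m + \<epsilon> * card {\<psi>\<in>S. m \<^bold>\<rightarrow> \<psi> \<in> U \<and> \<chi> \<^bold>\<rightarrow> \<psi> \<notin> U}) ` {m\<in>M. m \<^bold>\<rightarrow> \<chi> \<in> U})"

context
  fixes S U M :: "'v fm set" and v :: "'v fm \<Rightarrow> real" and \<epsilon> :: real
  assumes fin: "finite S" and U: "linear_theory U" and M: "M \<subseteq> S" "\<^bold>\<bottom> \<in> M" and eps: "0 < \<epsilon>"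
begin

private lemmas U_spread = linear_is_theory[OF U]

private lemma fin_below: "finite {m\<in>M. m \<^bold>\<rightarrow> \<chi> \<in> U}"
  using fin M finite_subset by (metis (no_types, lifting) mem_Collect_eq subset_iff)

text \<open>Ensures that the maximum in \<open>spread\<close> ranges over a nonempty set.\<close>

private lemma Bot_below: "\<^bold>\<bottom> \<in> {m\<in>M. m \<^bold>\<rightarrow> \<chi> \<in> U}"
  using M theory_thm[OF U_spread thm_G[OF G8]] by blast

lemma spread_ge:
  assumes "m \<in> M" "m \<^bold>\<rightarrow> \<chi> \<in> U"
  shows "v m + \<epsilon> * card {\<psi>\<in>S. m \<^bold>\<rightarrow> \<psi> \<in> U \<and> \<chi> \<^bold>\<rightarrow> \<psi> \<notin> U} \<le> spread S U M v \<epsilon> \<chi>"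
  unfolding spread_def using fin_below assms by (intro Max_ge) auto

lemma spread_cases:
  obtains m where "m \<in> M" "m \<^bold>\<rightarrow> \<chi> \<in> U"
    "spread S U M v \<epsilon> \<chi> = v m + \<epsilon> * card {\<psi>\<in>S. m \<^bold>\<rightarrow> \<psi> \<in> U \<and> \<chi> \<^bold>\<rightarrow> \<psi> \<notin> U}"
proof -
  have "spread S U M v \<epsilon> \<chi> \<in>
    (\<lambda>m. v m + \<epsilon> * card {\<psi>\<in>S. m \<^bold>\<rightarrow> \<psi> \<in> U \<and> \<chi> \<^bold>\<rightarrow> \<psi> \<notin> U}) ` {m\<in>M. m \<^bold>\<rightarrow> \<chi> \<in> U}"
    unfolding spread_def using fin_below Bot_below by (intro Max_in) auto
  then show thesis using that by blast
qed

lemma spread_mono: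
  assumes "\<chi> \<^bold>\<rightarrow> \<psi> \<in> U" shows "spread S U M v \<epsilon> \<chi> \<le> spread S U M v \<epsilon> \<psi>"
proof -
  obtain m where m: "m \<in> M" "m \<^bold>\<rightarrow> \<chi> \<in> U"
    "spread S U M v \<epsilon> \<chi> = v m + \<epsilon> * card {x\<in>S. m \<^bold>\<rightarrow> x \<in> U \<and> \<chi> \<^bold>\<rightarrow> x \<notin> U}"
    by (rule spread_cases)
  have "card {x\<in>S. m \<^bold>\<rightarrow> x \<in> U \<and> \<chi> \<^bold>\<rightarrow> x \<notin> U} \<le> card {x\<in>S. m \<^bold>\<rightarrow> x \<in> U \<and> \<psi> \<^bold>\<rightarrow> x \<notin> U}"
    using fin theory_trans[OF U_spread assms] by (intro card_mono) auto
  then have "spread S U M v \<epsilon> \<chi> \<le> v m + \<epsilon> * card {x\<in>S. m \<^bold>\<rightarrow> x \<in> U \<and> \<psi> \<^bold>\<rightarrow> x \<notin> U}"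
    using m(3) eps by simp
  also have "\<dots> \<le> spread S U M v \<epsilon> \<psi>" using spread_ge m(1) theory_trans[OF U_spread m(2) assms] .
  finally show ?thesis .
qed

text \<open>The \<open>m\<close> that attains the maximum for \<open>\<psi>\<close> also competes
  for \<open>\<chi>\<close>, where it counts \<open>\<psi>\<close> in addition.\<close>

lemma spread_less:
  assumes "\<chi> \<^bold>\<rightarrow> \<psi> \<notin> U" and "\<psi> \<in> S" shows "spread S U M v \<epsilon> \<psi> < spread S U M v \<epsilon> \<chi>"
proof -
  have le: "\<psi> \<^bold>\<rightarrow> \<chi> \<in> U" using linear_total[OF U assms(1)] .
  obtain m where m: "m \<in> M" "m \<^bold>\<rightarrow> \<psi> \<in> U"
    "spread S U M v \<epsilon> \<psi> = v m + \<epsilon> * card {x\<in>S. m \<^bold>\<rightarrow> x \<in> U \<and> \<psi> \<^bold>\<rightarrow> x \<notin> U}"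
    by (rule spread_cases)
  have "{x\<in>S. m \<^bold>\<rightarrow> x \<in> U \<and> \<psi> \<^bold>\<rightarrow> x \<notin> U} \<subset> {x\<in>S. m \<^bold>\<rightarrow> x \<in> U \<and> \<chi> \<^bold>\<rightarrow> x \<notin> U}"
    using theory_trans[OF U_spread le] theory_refl[OF U_spread] assms m(2) by blast
  then have "card {x\<in>S. m \<^bold>\<rightarrow> x \<in> U \<and> \<psi> \<^bold>\<rightarrow> x \<notin> U} < card {x\<in>S. m \<^bold>\<rightarrow> x \<in> U \<and> \<chi> \<^bold>\<rightarrow> x \<notin> U}"
    using fin by (intro psubset_card_mono) auto
  then have "spread S U M v \<epsilon> \<psi> < v m + \<epsilon> * card {x\<in>S. m \<^bold>\<rightarrow> x \<in> U \<and> \<chi> \<^bold>\<rightarrow> x \<notin> U}"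
    using m(3) eps by simp
  also have "\<dots> \<le> spread S U M v \<epsilon> \<chi>" using spread_ge m(1) theory_trans[OF U_spread m(2) le] .
  finally show ?thesis .
qed

lemma spread_le_iff:
  "\<psi> \<in> S \<Longrightarrow> spread S U M v \<epsilon> \<chi> \<le> spread S U M v \<epsilon> \<psi> \<longleftrightarrow> \<chi> \<^bold>\<rightarrow> \<psi> \<in> U"
  using spread_mono spread_less by (meson not_le)

private lemma eps_card_le: "\<epsilon> * card {x\<in>S. Q x} \<le> \<epsilon> * card S"
  using fin eps by (simp add: card_mono)

lemma spread_bound:
  assumes "\<And>m. m \<in> M \<Longrightarrow> m \<^bold>\<rightarrow> \<chi> \<in> U \<Longrightarrow> v m \<le> c"
  shows "spread S U M v \<epsilon> \<chi> \<le> c + \<epsilon> * card S"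
proof -
  obtain m where m: "m \<in> M" "m \<^bold>\<rightarrow> \<chi> \<in> U"
    "spread S U M v \<epsilon> \<chi> = v m + \<epsilon> * card {\<psi>\<in>S. m \<^bold>\<rightarrow> \<psi> \<in> U \<and> \<chi> \<^bold>\<rightarrow> \<psi> \<notin> U}"
    by (rule spread_cases)
  then show ?thesis
    using assms[OF m(1,2)] eps_card_le[of "\<lambda>\<psi>. m \<^bold>\<rightarrow> \<psi> \<in> U \<and> \<chi> \<^bold>\<rightarrow> \<psi> \<notin> U"] by linarith
qed

lemma spread_nonneg:
  assumes "v \<^bold>\<bottom> = 0" shows "0 \<le> spread S U M v \<epsilon> \<chi>"
proof -
  have "0 \<le> \<epsilon> * card {\<psi>\<in>S. \<^bold>\<bottom> \<^bold>\<rightarrow> \<psi> \<in> U \<and> \<chi> \<^bold>\<rightarrow> \<psi> \<notin> U}" using eps by simp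
  then show ?thesis using spread_ge[of "\<^bold>\<bottom>" \<chi>] Bot_below assms by fastforce
qed

text \<open>A competitor equivalent to \<open>m\<close> contributes an empty count, and one strictly
  below \<open>m\<close> is too low for \<open>\<epsilon> * card S\<close> to bridge the
  gap.\<close>

lemma spread_eq:
  assumes m: "m \<in> M"
    and gap: "\<And>m'. m' \<in> M \<Longrightarrow> m \<^bold>\<rightarrow> m' \<notin> U \<Longrightarrow> v m' + \<epsilon> * card S \<le> v m"
    and eq: "\<And>m'. m' \<in> M \<Longrightarrow> m \<^bold>\<rightarrow> m' \<in> U \<Longrightarrow> m' \<^bold>\<rightarrow> m \<in> U \<Longrightarrow> v m' \<le> v m"
  shows "spread S U M v \<epsilon> m = v m"
proof (rule antisym)
  obtain m' where m': "m' \<in> M" "m' \<^bold>\<rightarrow> m \<in> U"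
    "spread S U M v \<epsilon> m = v m' + \<epsilon> * card {x\<in>S. m' \<^bold>\<rightarrow> x \<in> U \<and> m \<^bold>\<rightarrow> x \<notin> U}"
    by (rule spread_cases)
  show "spread S U M v \<epsilon> m \<le> v m"
  proof (cases "m \<^bold>\<rightarrow> m' \<in> U")
    case True
    then have empty: "{x\<in>S. m' \<^bold>\<rightarrow> x \<in> U \<and> m \<^bold>\<rightarrow> x \<notin> U} = {}" using theory_trans[OF U_spread] by blast
    show ?thesis using eq[OF m'(1) True m'(2)] m'(3) unfolding empty by simp
  next
    case False
    then show ?thesis using gap[OF m'(1)] m'(3)
        eps_card_le[of "\<lambda>x. m' \<^bold>\<rightarrow> x \<in> U \<and> m \<^bold>\<rightarrow> x \<notin> U"] by linarith
  qed
next
  have "0 \<le> \<epsilon> * card {\<psi>\<in>S. m \<^bold>\<rightarrow> \<psi> \<in> U \<and> m \<^bold>\<rightarrow> \<psi> \<notin> U}" using eps by simp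
  then show "v m \<le> spread S U M v \<epsilon> m" using spread_ge[OF m theory_refl[OF U_spread]] by linarith
qed

end

text \<open>Formulas in \<open>U\<close> need not get the value 1: the modal formulas in \<open>U\<close> keep their
  values \<open>v\<close>, which only have to be at least the threshold that separates \<open>U\<close> from the rest.\<close>

primrec lift :: "'v fm set \<Rightarrow> ('v fm \<Rightarrow> real) \<Rightarrow> ('v fm \<Rightarrow> real) \<Rightarrow> 'v fm \<Rightarrow> real" where
  "lift U u v (Var p) = (if Var p \<in> U then 1 else u (Var p))"
| "lift U u v \<^bold>\<bottom> = 0"
| "lift U u v (\<phi> \<^bold>\<and> \<psi>) = min (lift U u v \<phi>) (lift U u v \<psi>)"
| "lift U u v (\<phi> \<^bold>\<rightarrow> \<psi>) = (lift U u v \<phi> \<Rightarrow>\<^sub>G lift U u v \<psi>)"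
| "lift U u v (\<box>\<phi>) = v (\<box>\<phi>)"
| "lift U u v (\<diamond>\<phi>) = v (\<diamond>\<phi>)"

section \<open>Subformulas and the truth lemma for a single world\<close>

primrec sub :: "'v fm \<Rightarrow> 'v fm set" where
  "sub (Var p) = {Var p}"
| "sub \<^bold>\<bottom> = {\<^bold>\<bottom>}"
| "sub (\<phi> \<^bold>\<and> \<psi>) = insert (\<phi> \<^bold>\<and> \<psi>) (sub \<phi> \<union> sub \<psi>)"
| "sub (\<phi> \<^bold>\<rightarrow> \<psi>) = insert (\<phi> \<^bold>\<rightarrow> \<psi>) (sub \<phi> \<union> sub \<psi>)"
| "sub (\<box>\<phi>) = insert (\<box>\<phi>) (sub \<phi>)"
| "sub (\<diamond>\<phi>) = insert (\<diamond>\<phi>) (sub \<phi>)"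

lemma sub_refl: "\<phi> \<in> sub \<phi>"
  by (cases \<phi>) auto

lemma finite_sub: "finite (sub \<phi>)"
  by (induction \<phi>) auto

definition sub_closed :: "'v fm set \<Rightarrow> bool" where
  "sub_closed S \<longleftrightarrow> (\<forall>\<phi>\<in>S. sub \<phi> \<subseteq> S)"

lemma sub_closed_sub: "sub_closed (sub \<phi>)"
  unfolding sub_closed_def by (induction \<phi>) auto

lemma sub_closed_insert_Bot: "sub_closed S \<Longrightarrow> sub_closed (insert \<^bold>\<bottom> S)"
  by (auto simp: sub_closed_def)

lemma sub_closedD:
  assumes "sub_closed S"
  shows "\<phi> \<^bold>\<and> \<psi> \<in> S \<Longrightarrow> \<phi> \<in> S \<and> \<psi> \<in> S" "\<phi> \<^bold>\<rightarrow> \<psi> \<in> S \<Longrightarrow> \<phi> \<in> S \<and> \<psi> \<in> S"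
    "\<box>\<phi> \<in> S \<Longrightarrow> \<phi> \<in> S" "\<diamond>\<phi> \<in> S \<Longrightarrow> \<phi> \<in> S"
  using assms sub_refl[of \<phi>] sub_refl[of \<psi>] by (fastforce simp: sub_closed_def)+

text \<open>Members of \<open>U\<close> lie at or above \<open>t\<close>, all others strictly below.
  Exact values and the order are needed only below \<open>t\<close>, so a lower bound on
  \<open>U\<close> is enough for the induction.\<close>

lemma lift_spec:
  assumes S: "sub_closed S" and U: "linear_theory U" "\<^bold>\<bottom> \<notin> U" and t: "t \<le> 1"
    and u_less: "\<And>\<chi>. \<chi> \<in> S \<Longrightarrow> \<chi> \<notin> U \<Longrightarrow> u \<chi> < t"
    and u_le_iff: "\<And>\<chi> \<psi>. \<chi> \<in> S \<Longrightarrow> \<psi> \<in> S \<Longrightarrow> \<chi> \<notin> U \<Longrightarrow> \<psi> \<notin> U \<Longrightarrow> u \<chi> \<le> u \<psi> \<longleftrightarrow> \<chi> \<^bold>\<rightarrow> \<psi> \<in> U"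
    and u_Bot: "u \<^bold>\<bottom> = 0"
    and v_eq: "\<And>m. m \<in> S \<Longrightarrow> modal m \<Longrightarrow> m \<notin> U \<Longrightarrow> v m = u m"
    and v_ge: "\<And>m. m \<in> S \<Longrightarrow> modal m \<Longrightarrow> m \<in> U \<Longrightarrow> t \<le> v m"
  shows "\<chi> \<in> S \<Longrightarrow> (\<chi> \<notin> U \<longrightarrow> lift U u v \<chi> = u \<chi>) \<and> (\<chi> \<in> U \<longrightarrow> t \<le> lift U u v \<chi>)"
proof (induction \<chi>)
  case (Var p)
  then show ?case using t by simp
next
  case Bot
  then show ?case using U u_Bot by simp
next
  case (Conj \<phi> \<psi>)
  note th = linear_is_theory[OF U(1)]
  have in_S: "\<phi> \<in> S" "\<psi> \<in> S" using sub_closedD(1)[OF S Conj.prems] by auto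
  have eqv: "u a = u b" if "a \<in> S" "b \<in> S" "a \<notin> U" "b \<notin> U" "a \<^bold>\<rightarrow> b \<in> U" "b \<^bold>\<rightarrow> a \<in> U" for a b
    using u_le_iff that by (meson order_antisym)
  have c1: "\<phi> \<^bold>\<and> \<psi> \<^bold>\<rightarrow> \<phi> \<in> U" "\<phi> \<^bold>\<and> \<psi> \<^bold>\<rightarrow> \<psi> \<in> U"
    using theory_Imp_Conj_iff[OF th] theory_refl[OF th] by blast+
  show ?case
  proof (intro conjI impI)
    assume "\<phi> \<^bold>\<and> \<psi> \<in> U"
    then show "t \<le> lift U u v (\<phi> \<^bold>\<and> \<psi>)" using Conj in_S theory_Conj_iff[OF th] by simp
  next
    assume n: "\<phi> \<^bold>\<and> \<psi> \<notin> U"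
    consider "\<phi> \<^bold>\<rightarrow> \<psi> \<in> U" | "\<psi> \<^bold>\<rightarrow> \<phi> \<in> U" using linear_total[OF U(1)] by blast
    then show "lift U u v (\<phi> \<^bold>\<and> \<psi>) = u (\<phi> \<^bold>\<and> \<psi>)"
    proof cases
      case 1
      then have "\<phi> \<^bold>\<rightarrow> \<phi> \<^bold>\<and> \<psi> \<in> U" using theory_Imp_Conj_iff[OF th] theory_refl[OF th] by blast
      moreover from this have "\<phi> \<notin> U" using n theory_mp[OF th] by blast
      ultimately have "u \<phi> = u (\<phi> \<^bold>\<and> \<psi>)" using eqv Conj.prems in_S n c1 by blast
      \<comment> \<open>If \<open>\<psi>\<close> is in \<open>U\<close>, the threshold separates the
        two values; otherwise \<open>u\<close> compares them.\<close>
      moreover have "lift U u v \<phi> \<le> lift U u v \<psi>"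
        using Conj.IH in_S 1 \<open>\<phi> \<notin> U\<close> u_le_iff u_less by (cases "\<psi> \<in> U") fastforce+
      ultimately show ?thesis using Conj.IH(1) in_S \<open>\<phi> \<notin> U\<close> by simp
    next
      case 2
      then have "\<psi> \<^bold>\<rightarrow> \<phi> \<^bold>\<and> \<psi> \<in> U" using theory_Imp_Conj_iff[OF th] theory_refl[OF th] by blast
      moreover from this have "\<psi> \<notin> U" using n theory_mp[OF th] by blast
      ultimately have "u \<psi> = u (\<phi> \<^bold>\<and> \<psi>)" using eqv Conj.prems in_S n c1 by blast
      moreover have "lift U u v \<psi> \<le> lift U u v \<phi>"
        using Conj.IH in_S 2 \<open>\<psi> \<notin> U\<close> u_le_iff u_less by (cases "\<phi> \<in> U") fastforce+
      ultimately show ?thesis using Conj.IH(2) in_S \<open>\<psi> \<notin> U\<close> by simp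
    qed
  qed
next
  case (Imp \<phi> \<psi>)
  note th = linear_is_theory[OF U(1)]
  have in_S: "\<phi> \<in> S" "\<psi> \<in> S" using sub_closedD(2)[OF S Imp.prems] by auto
  show ?case
  proof (cases "\<phi> \<^bold>\<rightarrow> \<psi> \<in> U")
    case True
    have "t \<le> lift U u v (\<phi> \<^bold>\<rightarrow> \<psi>)"
    proof (cases "\<psi> \<in> U")
      case True
      \<comment> \<open>The implication evaluates to 1 or to the value of \<open>\<psi>\<close>, and
        both are at least \<open>t\<close>.\<close>
      then show ?thesis using Imp.IH in_S t by (simp add: godel_imp_def)
    next
      case False
      then have "\<phi> \<notin> U" using \<open>\<phi> \<^bold>\<rightarrow> \<psi> \<in> U\<close> theory_mp[OF th] by blast
      then show ?thesis using False Imp.IH in_S u_le_iff[of \<phi> \<psi>] True t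
        by (simp add: godel_imp_def)
    qed
    then show ?thesis using True by blast
  next
    case False
    then have "\<psi> \<notin> U" using theory_weaken[OF th] by blast
    then have psi: "lift U u v \<psi> = u \<psi>" using Imp.IH in_S by blast
    have "u \<psi> < lift U u v \<phi>"
      using Imp.IH(1) in_S u_le_iff[of \<phi> \<psi>] u_less[of \<psi>] \<open>\<psi> \<notin> U\<close> False by (cases "\<phi> \<in> U") fastforce+
    then have "lift U u v (\<phi> \<^bold>\<rightarrow> \<psi>) = u \<psi>" using psi by (simp add: godel_imp_def)
    \<comment> \<open>Both formulas are equivalent in \<open>U\<close>, by
      \<open>linear_residuum\<close> and weakening.\<close>
    moreover have "u \<psi> = u (\<phi> \<^bold>\<rightarrow> \<psi>)"
      using u_le_iff[of \<psi> "\<phi> \<^bold>\<rightarrow> \<psi>"] u_le_iff[of "\<phi> \<^bold>\<rightarrow> \<psi>" \<psi>] in_S Imp.prems False \<open>\<psi> \<notin> U\<close>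
        linear_residuum[OF U(1) False] theory_thm[OF th thm_K] by (meson order_antisym)
    ultimately show ?thesis using False by simp
  qed
next
  case (Box \<phi>)
  then show ?case using v_eq[OF Box.prems modal_Box] v_ge[OF Box.prems modal_Box] by simp
next
  case (Dia \<phi>)
  then show ?case using v_eq[OF Dia.prems modal_Dia] v_ge[OF Dia.prems modal_Dia] by simp
qed

section \<open>Construction of single worlds\<close>

text \<open>Everything about a world with possibility \<open>p\<close> and truth values
  \<open>w\<close> that can be checked without the other worlds. The last two clauses are one half
  of the modal truth conditions; the other half needs witnessing worlds.\<close>

definition admissible :: "'v fm set \<Rightarrow> ('v fm \<Rightarrow> real) \<Rightarrow> real \<Rightarrow> ('v fm \<Rightarrow> real) \<Rightarrow> bool" where
  "admissible S v p w \<longleftrightarrow> p \<in> {0..1} \<and> (\<forall>q. w (Var q) \<in> {0..1}) \<and> w \<^bold>\<bottom> = 0 \<and>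
     (\<forall>\<phi> \<psi>. w (\<phi> \<^bold>\<and> \<psi>) = min (w \<phi>) (w \<psi>)) \<and> (\<forall>\<phi> \<psi>. w (\<phi> \<^bold>\<rightarrow> \<psi>) = (w \<phi> \<Rightarrow>\<^sub>G w \<psi>)) \<and>
     (\<forall>\<phi>. w (\<box>\<phi>) = v (\<box>\<phi>)) \<and> (\<forall>\<phi>. w (\<diamond>\<phi>) = v (\<diamond>\<phi>)) \<and>
     (\<forall>\<phi>. \<box>\<phi> \<in> S \<longrightarrow> min (v (\<box>\<phi>)) p \<le> w \<phi>) \<and>
     (\<forall>\<phi>. \<diamond>\<phi> \<in> S \<longrightarrow> min p (w \<phi>) \<le> v (\<diamond>\<phi>))"

context
  fixes S T :: "'v fm set"
  assumes fin: "finite S" and S: "sub_closed S" and Bot: "\<^bold>\<bottom> \<in> S"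
    and T: "linear_theory T" and T_Bot: "\<^bold>\<bottom> \<notin> T"
begin

text \<open>Possibility 0 makes the last two clauses of admissibility trivial, so the refuting world
  may come from \<open>T\<close> itself, with threshold 1.\<close>

lemma initial_world:
  obtains w where "admissible S (rank S T) 0 w" "\<And>\<chi>. \<chi> \<in> S \<Longrightarrow> \<chi> \<notin> T \<Longrightarrow> w \<chi> < 1"
proof
  let ?w = "lift T (rank S T) (rank S T)"
  have spec: "(\<chi> \<notin> T \<longrightarrow> ?w \<chi> = rank S T \<chi>) \<and> (\<chi> \<in> T \<longrightarrow> 1 \<le> ?w \<chi>)" if "\<chi> \<in> S" for \<chi>
    using rank_less_1[OF fin T] rank_le_iff[OF fin T] rank_Bot[OF fin T T_Bot] rank_eq_1[of _ T S]
    by (intro lift_spec[OF S T T_Bot _ _ _ _ _ _ that]) auto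
  then show "\<chi> \<in> S \<Longrightarrow> \<chi> \<notin> T \<Longrightarrow> ?w \<chi> < 1" for \<chi> using rank_less_1[OF fin T] by simp
  have "0 \<le> ?w \<chi>" if "\<chi> \<in> S" for \<chi> using spec[OF that] rank_nonneg[of S T \<chi>] by linarith
  then show "admissible S (rank S T) 0 ?w"
    using rank_nonneg[of S T] rank_le_1[OF fin T] sub_closedD(3)[OF S]
    by (auto simp: admissible_def min_le_iff_disj)
qed

text \<open>The threshold \<open>t\<close> separates modal members of \<open>U\<close>, which keep
  their ranks, from the formulas outside \<open>U\<close>, which \<open>spread\<close> squeezes to
  at most \<open>\<delta>\<close> above the rank of \<open>e\<close>. The parameter
  \<open>\<delta>\<close> lets a box value be approximated arbitrarily well.\<close>

lemma accessible_world:
  assumes e: "e \<in> S" "modal e" "e \<notin> T" and acc: "accessible T e U"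
    and t: "t \<le> 1" "rank S T e + 1 / (real (card S) + 1) \<le> t"
    and t_le: "\<And>m. m \<in> S \<Longrightarrow> modal m \<Longrightarrow> m \<in> U \<Longrightarrow> t \<le> rank S T m"
    and \<delta>: "0 < \<delta>" "\<delta> < 1 / (real (card S) + 1)"
  obtains w where "admissible S (rank S T) t w"
    "\<And>\<chi>. \<chi> \<in> S \<Longrightarrow> \<chi> \<notin> U \<Longrightarrow> w \<chi> < t \<and> w \<chi> \<le> rank S T e + \<delta>"
    "\<And>\<chi>. \<chi> \<in> S \<Longrightarrow> \<chi> \<in> U \<Longrightarrow> t \<le> w \<chi>"
proof
  define v where "v = rank S T"
  define M where "M = {m\<in>S. modal m}"
  \<comment> \<open>Counts are at most \<open>card S\<close>, so the total shift stays within
    \<open>\<delta>\<close>.\<close>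
  define \<epsilon> where "\<epsilon> = \<delta> / (real (card S) + 1)"
  define u where "u = spread S U M v \<epsilon>"
  let ?w = "lift U u v"
  have U: "linear_theory U" "e \<notin> U" using acc by (auto simp: accessible_def)
  note th = linear_is_theory[OF U(1)]
  have U_Bot: "\<^bold>\<bottom> \<notin> U" using U(2) theory_mp[OF th] theory_thm[OF th thm_G[OF G8]] by blast
  have eps: "0 < \<epsilon>" "\<epsilon> * card S \<le> \<delta>" using \<delta> by (auto simp: \<epsilon>_def field_simps)
  have M: "M \<subseteq> S" "\<^bold>\<bottom> \<in> M" using Bot modal_Bot by (auto simp: M_def)
  note ctx = fin U(1) M eps(1)
  have v_Bot: "v \<^bold>\<bottom> = 0" unfolding v_def using rank_Bot[OF fin T T_Bot] .
  have mod_iff: "m \<in> U \<longleftrightarrow> m \<^bold>\<rightarrow> e \<notin> T" if "modal m" for m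
    using accessible_modal_iff[OF T e(3) acc e(2) that] .
  have imp_iff: "a \<^bold>\<rightarrow> b \<in> U \<longleftrightarrow> a \<^bold>\<rightarrow> b \<in> T" if "modal a" "modal b" "b \<notin> U" for a b
    using accessible_modal_Imp_iff[OF T e(3) acc that] .
  have u_le: "u \<chi> \<le> v e + \<delta>" if "\<chi> \<notin> U" for \<chi>
  proof -
    have "v m \<le> v e" if m: "m \<in> M" "m \<^bold>\<rightarrow> \<chi> \<in> U" for m
    proof -
      have "m \<notin> U" using m(2) \<open>\<chi> \<notin> U\<close> theory_mp[OF th] by blast
      then show ?thesis using mod_iff m(1) rank_mono[OF fin T] by (auto simp: M_def v_def)
    qed
    then have "u \<chi> \<le> v e + \<epsilon> * card S" unfolding u_def using spread_bound[OF ctx] by blast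
    then show ?thesis using eps(2) by linarith
  qed
  have u_less: "u \<chi> < t" if "\<chi> \<notin> U" for \<chi> using u_le[OF that] t(2) \<delta>(2) by (simp add: v_def)
  have u_eq: "v m = u m" if m: "m \<in> S" "modal m" "m \<notin> U" for m
    unfolding u_def
  proof (rule sym, rule spread_eq[OF ctx])
    show "m \<in> M" using m by (simp add: M_def)
  next
    fix m' assume m': "m' \<in> M" "m \<^bold>\<rightarrow> m' \<notin> U"
    then have "m' \<notin> U" using theory_weaken[OF th] by blast
    \<comment> \<open>Below the cut, \<open>U\<close> and \<open>T\<close> agree on modal formulas;
      in \<open>T\<close>, a strict comparison costs a whole rank gap, which exceeds
      \<open>\<delta>\<close>.\<close>
    then have "m \<^bold>\<rightarrow> m' \<notin> T" using imp_iff m m' by (auto simp: M_def)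
    then have "v m' + 1 / (real (card S) + 1) \<le> v m"
      unfolding v_def using rank_less[OF fin T] m'(1) by (auto simp: M_def)
    then show "v m' + \<epsilon> * card S \<le> v m" using eps(2) \<delta>(2) by linarith
  next
    fix m' assume m': "m' \<in> M" "m' \<^bold>\<rightarrow> m \<in> U"
    then have "m' \<^bold>\<rightarrow> m \<in> T" using imp_iff m by (auto simp: M_def)
    then show "v m' \<le> v m" unfolding v_def using rank_mono[OF fin T] by blast
  qed
  have u_Bot: "u \<^bold>\<bottom> = 0" using u_eq[OF Bot modal_Bot U_Bot] v_Bot by simp
  have spec: "(\<chi> \<notin> U \<longrightarrow> ?w \<chi> = u \<chi>) \<and> (\<chi> \<in> U \<longrightarrow> t \<le> ?w \<chi>)" if "\<chi> \<in> S" for \<chi>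
  proof (rule lift_spec[where S = S and U = U and t = t and u = u and v = v, OF S U(1) U_Bot t(1) _ _ u_Bot _ _ that])
    show "v m = u m" if "m \<in> S" "modal m" "m \<notin> U" for m using u_eq[OF that] .
    show "u \<chi> < t" if "\<chi> \<notin> U" for \<chi> using u_less[OF that] .
    show "u \<chi> \<le> u \<psi> \<longleftrightarrow> \<chi> \<^bold>\<rightarrow> \<psi> \<in> U" if "\<psi> \<in> S" for \<chi> \<psi>
      unfolding u_def using spread_le_iff[OF ctx that] .
    show "t \<le> v m" if "m \<in> S" "modal m" "m \<in> U" for m using t_le[OF that] by (simp add: v_def)
  qed
  show "?w \<chi> < t \<and> ?w \<chi> \<le> rank S T e + \<delta>" if "\<chi> \<in> S" "\<chi> \<notin> U" for \<chi>
    using spec[OF that(1)] that(2) u_le u_less by (simp add: v_def)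
  show "t \<le> ?w \<chi>" if "\<chi> \<in> S" "\<chi> \<in> U" for \<chi> using spec that by blast
  have box: "min (v (\<box>\<chi>)) t \<le> ?w \<chi>" if "\<box>\<chi> \<in> S" for \<chi>
  proof (cases "\<chi> \<in> U")
    case True
    then show ?thesis using spec[OF sub_closedD(3)[OF S that]] by linarith
  next
    case False
    \<comment> \<open>As \<open>\<box>\<chi> \<rightarrow> \<chi>\<close> is in \<open>U\<close>,
      the box is outside \<open>U\<close> together with \<open>\<chi>\<close>, and
      \<open>spread\<close> is monotone. The diamond case is dual.\<close>
    then have "\<box>\<chi> \<notin> U" using accessible_Box[OF T e(3) acc] theory_mp[OF th] by blast
    then have "v (\<box>\<chi>) = u (\<box>\<chi>)" using u_eq[OF that modal_Box] by blast
    also have "\<dots> \<le> u \<chi>" unfolding u_def using spread_mono[OF ctx accessible_Box[OF T e(3) acc]] .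
    finally show ?thesis using spec[OF sub_closedD(3)[OF S that]] False by linarith
  qed
  have dia: "min t (?w \<chi>) \<le> v (\<diamond>\<chi>)" if "\<diamond>\<chi> \<in> S" for \<chi>
  proof (cases "\<diamond>\<chi> \<in> U")
    case True
    then show ?thesis using t_le[OF that modal_Dia] by (simp add: v_def)
  next
    case False
    then have "\<chi> \<notin> U" using accessible_Dia[OF T e(3) acc] theory_mp[OF th] by blast
    then have "?w \<chi> = u \<chi>" using spec[OF sub_closedD(4)[OF S that]] by blast
    also have "\<dots> \<le> u (\<diamond>\<chi>)" unfolding u_def using spread_mono[OF ctx accessible_Dia[OF T e(3) acc]] .
    also have "\<dots> = v (\<diamond>\<chi>)" using u_eq[OF that modal_Dia False] by simp
    finally show ?thesis by linarith
  qed
  have "0 \<le> v e" by (simp add: v_def rank_nonneg)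
  moreover have "0 < 1 / (real (card S) + 1)" by simp
  ultimately have "0 \<le> t" using t(2) unfolding v_def by linarith
  moreover have "0 \<le> u \<chi>" for \<chi> unfolding u_def using spread_nonneg[where v = v, OF ctx v_Bot] .
  ultimately show "admissible S (rank S T) t ?w"
    using t(1) box dia u_less less_imp_le[OF less_le_trans[OF u_less t(1)]]
    unfolding admissible_def v_def by auto
qed

text \<open>With the cut at \<open>\<box>\<theta>\<close> and the threshold one gap higher,
  \<open>\<theta>\<close> is left out of \<open>U\<close> and lands just above the cut. Being below
  the possibility degree, its value is that of the implication under the infimum.\<close>

lemma Box_world:
  assumes b: "\<box>\<theta> \<in> S" "rank S T (\<box>\<theta>) < 1"
  shows "\<exists>t w. admissible S (rank S T) t w \<and> w \<theta> < t \<and>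
    w \<theta> \<le> rank S T (\<box>\<theta>) + inverse (Suc n)"
proof -
  have n: "\<box>\<theta> \<notin> T" using b(2) rank_eq_1[of _ T S] by fastforce
  obtain U where U: "accessible T (\<box>\<theta>) U" "\<theta> \<notin> U" using accessible_extend_Box[OF T n] .
  let ?t = "rank S T (\<box>\<theta>) + 1 / (real (card S) + 1)"
  \<comment> \<open>The second term is strictly smaller than the rank gap
    \<open>1 / (card S + 1)\<close>.\<close>
  define \<delta> where "\<delta> = min (inverse (Suc n)) (1 / (real (card S) + 2))"
  have \<delta>: "0 < \<delta>" "\<delta> < 1 / (real (card S) + 1)" "\<delta> \<le> inverse (Suc n)"
  proof -
    show "0 < \<delta>" "\<delta> \<le> inverse (Suc n)" by (auto simp: \<delta>_def)
    have "1 / (real (card S) + 2) < 1 / (real (card S) + 1)" by (simp add: field_simps)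
    then show "\<delta> < 1 / (real (card S) + 1)" by (simp add: \<delta>_def)
  qed
  have ge: "?t \<le> rank S T m" if "m \<in> S" "modal m" "m \<in> U" for m
    using accessible_modal_iff[OF T n U(1) modal_Box that(2)] that(3) rank_less[OF fin T _ b(1)]
    by blast
  obtain w where w: "admissible S (rank S T) ?t w"
    "\<And>\<chi>. \<chi> \<in> S \<Longrightarrow> \<chi> \<notin> U \<Longrightarrow> w \<chi> < ?t \<and> w \<chi> \<le> rank S T (\<box>\<theta>) + \<delta>"
    by (rule accessible_world[OF b(1) modal_Box n U(1) rank_le_gap[OF fin T n] order_refl _ \<delta>(1,2)])
      (use ge in blast)+
  have "w \<theta> < ?t \<and> w \<theta> \<le> rank S T (\<box>\<theta>) + \<delta>" using w(2) sub_closedD(3)[OF S b(1)] U(2) by blast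
  then show ?thesis using w(1) \<delta>(3) by (smt (verit))
qed

text \<open>The cut is a modal formula of \<open>S\<close> with the largest rank below that of
  \<open>\<diamond>\<theta>\<close>; falsum shows that one exists. Modal members of \<open>U\<close>
  in \<open>S\<close> then have at least the rank of \<open>\<diamond>\<theta>\<close>, which can
  serve as the threshold.\<close>

lemma Dia_world:
  assumes d: "\<diamond>\<theta> \<in> S" "0 < rank S T (\<diamond>\<theta>)"
  shows "\<exists>t w. admissible S (rank S T) t w \<and> rank S T (\<diamond>\<theta>) \<le> min t (w \<theta>)"
proof -
  let ?v = "rank S T" and ?t = "rank S T (\<diamond>\<theta>)"
  let ?L = "{m\<in>S. modal m \<and> ?v m < ?t}"
  have "finite ?L" using fin by simp
  moreover have "\<^bold>\<bottom> \<in> ?L" using Bot modal_Bot rank_Bot[OF fin T T_Bot] d(2) by simp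
  ultimately have "Max (?v ` ?L) \<in> ?v ` ?L" by (intro Max_in) auto
  then obtain e where e: "e \<in> ?L" "?v e = Max (?v ` ?L)" by auto
  have mx: "?v m \<le> ?v e" if "m \<in> ?L" for m
    unfolding e(2) using \<open>finite ?L\<close> that by (intro Max_ge) auto
  note e = e(1)
  have eT: "e \<notin> T" using e rank_eq_1[of e T S] rank_le_1[OF fin T, of "\<diamond>\<theta>"] by force
  have de: "\<diamond>\<theta> \<^bold>\<rightarrow> e \<notin> T" using e rank_le_iff[OF fin T, of e "\<diamond>\<theta>"] by auto
  obtain U where U: "accessible T e U" "\<theta> \<in> U"
    using accessible_extend_Dia[OF T eT _ de] e by blast
  have ge: "?t \<le> ?v m" if m: "m \<in> S" "modal m" "m \<in> U" for m
  proof (rule ccontr)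
    assume "\<not> ?t \<le> ?v m"
    then have "?v m \<le> ?v e" using mx m by simp
    then have "m \<^bold>\<rightarrow> e \<in> T" using rank_le_iff[OF fin T] e by blast
    then show False using accessible_modal_iff[OF T eT U(1) _ m(2)] m(3) e by blast
  qed
  have gap: "?v e + 1 / (real (card S) + 1) \<le> ?t" using rank_less[OF fin T de] e by blast
  have \<delta>: "0 < 1 / (real (card S) + 2)" "1 / (real (card S) + 2) < 1 / (real (card S) + 1)"
    by (simp_all add: field_simps)
  have e': "e \<in> S" "modal e" using e by auto
  obtain w where "admissible S ?v ?t w" "\<And>\<chi>. \<chi> \<in> S \<Longrightarrow> \<chi> \<in> U \<Longrightarrow> ?t \<le> w \<chi>"
    by (rule accessible_world[OF e' eT U(1) rank_le_1[OF fin T] gap _ \<delta>]) (use ge in blast)+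
  then show ?thesis using U(2) sub_closedD(4)[OF S d(1)] by force
qed

end

section \<open>Completeness\<close>

text \<open>Admissibility bounds each infimum from below and each supremum from above by
  \<open>v\<close>; the witnesses give the reverse bounds. A box of value 1 or a diamond of value 0
  gets its reverse bound from the unit interval.\<close>

lemma eval_admissible:
  fixes W :: "'w set" and w :: "'w \<Rightarrow> 'v fm \<Rightarrow> real"
  assumes S: "sub_closed S" and W: "W \<noteq> {}"
    and adm: "\<And>x. x \<in> W \<Longrightarrow> admissible S v (\<pi> x) (w x)"
    and v: "\<And>\<phi>. 0 \<le> v \<phi>" "\<And>\<phi>. v \<phi> \<le> 1"
    and box: "\<And>\<phi> n. \<box>\<phi> \<in> S \<Longrightarrow> v (\<box>\<phi>) < 1 \<Longrightarrow>
      \<exists>x\<in>W. w x \<phi> < \<pi> x \<and> w x \<phi> \<le> v (\<box>\<phi>) + inverse (Suc n)"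
    and dia: "\<And>\<phi>. \<diamond>\<phi> \<in> S \<Longrightarrow> 0 < v (\<diamond>\<phi>) \<Longrightarrow> \<exists>x\<in>W. v (\<diamond>\<phi>) \<le> min (\<pi> x) (w x \<phi>)"
  defines "e \<equiv> \<lambda>x p. w x (Var p)"
  shows "PiG_model W \<pi> e" and "\<phi> \<in> S \<Longrightarrow> x \<in> W \<Longrightarrow> eval W \<pi> e x \<phi> = w x \<phi>"
proof -
  show model: "PiG_model W \<pi> e"
    using W adm by (auto simp: PiG_model_def admissible_def e_def)
  show "\<phi> \<in> S \<Longrightarrow> x \<in> W \<Longrightarrow> eval W \<pi> e x \<phi> = w x \<phi>"
  proof (induction \<phi> arbitrary: x)
    case (Var p)
    then show ?case by (simp add: e_def)
  next
    case Bot
    then show ?case using adm[of x] by (simp add: admissible_def)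
  next
    case (Conj \<phi> \<psi>)
    then show ?case using adm[of x] sub_closedD(1)[OF S Conj.prems(1)] by (simp add: admissible_def)
  next
    case (Imp \<phi> \<psi>)
    then show ?case using adm[of x] sub_closedD(2)[OF S Imp.prems(1)] by (simp add: admissible_def)
  next
    case (Box \<phi>)
    have IH: "eval W \<pi> e y \<phi> = w y \<phi>" if "y \<in> W" for y
      using Box.IH sub_closedD(3)[OF S Box.prems(1)] that by blast
    have "v (\<box>\<phi>) \<le> eval W \<pi> e x (\<box>\<phi>)"
      unfolding le_eval_Box_iff[OF model v(2)] using IH adm Box.prems(1) by (simp add: admissible_def)
    moreover have "eval W \<pi> e x (\<box>\<phi>) \<le> v (\<box>\<phi>)"
    proof (rule ccontr)
      assume c: "\<not> ?thesis"
      \<comment> \<open>An excess over \<open>v\<close> would be larger than some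
        \<open>1 / (n + 1)\<close>, contradicting the corresponding witness.\<close>
      then obtain n where n: "inverse (real (Suc n)) < eval W \<pi> e x (\<box>\<phi>) - v (\<box>\<phi>)"
        using reals_Archimedean[of "eval W \<pi> e x (\<box>\<phi>) - v (\<box>\<phi>)"] by auto
      have "v (\<box>\<phi>) < 1" using c eval_le_1[OF model Box.prems(2), of "\<box>\<phi>"] by linarith
      then obtain y where y: "y \<in> W" "w y \<phi> < \<pi> y" "w y \<phi> \<le> v (\<box>\<phi>) + inverse (Suc n)"
        using box[OF Box.prems(1)] by blast
      have "eval W \<pi> e x (\<box>\<phi>) \<le> w y \<phi>"
        using eval_Box_lower[OF model y(1), of x \<phi>] IH[OF y(1)] y(2) by (simp add: godel_imp_def)
      then show False using n y(3) by linarith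
    qed
    ultimately show ?case using adm[OF Box.prems(2)] by (simp add: admissible_def)
  next
    case (Dia \<phi>)
    have IH: "eval W \<pi> e y \<phi> = w y \<phi>" if "y \<in> W" for y
      using Dia.IH sub_closedD(4)[OF S Dia.prems(1)] that by blast
    have "eval W \<pi> e x (\<diamond>\<phi>) \<le> v (\<diamond>\<phi>)"
      unfolding eval_Dia_le_iff[OF model] using IH adm Dia.prems(1) by (simp add: admissible_def)
    moreover have "v (\<diamond>\<phi>) \<le> eval W \<pi> e x (\<diamond>\<phi>)"
    proof (cases "0 < v (\<diamond>\<phi>)")
      case True
      then obtain y where y: "y \<in> W" "v (\<diamond>\<phi>) \<le> min (\<pi> y) (w y \<phi>)" using dia[OF Dia.prems(1)] by blast
      then show ?thesis using eval_Dia_upper[OF model y(1), of \<phi> x] IH[OF y(1)] by linarith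
    next
      case False
      then show ?thesis using eval_nonneg[OF model Dia.prems(2), of "\<diamond>\<phi>"] by linarith
    qed
    ultimately show ?case using adm[OF Dia.prems(2)] by (simp add: admissible_def)
  qed
qed

section \<open>A countable countermodel in an arbitrary infinite universe\<close>

lemma completeness:
  fixes \<phi> :: "'v fm"
  assumes inf: "infinite (UNIV :: 'w set)" and valid: "PiG_valid TYPE('w) \<phi>"
  shows "\<turnstile>\<^sub>K\<^sub>4\<^sub>5\<^sub>G \<phi>"
proof (rule ccontr)
  assume "\<not> \<turnstile>\<^sub>K\<^sub>4\<^sub>5\<^sub>G \<phi>"
  then obtain T where T: "linear_theory T" "\<phi> \<notin> T"
    using linear_extension[OF is_theory_theorems, of \<phi>] by auto
  have T_Bot: "\<^bold>\<bottom> \<notin> T"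
    using T(2) theory_mp[OF linear_is_theory[OF T(1)]]
      theory_thm[OF linear_is_theory[OF T(1)] thm_G[OF G8]] by blast
  \<comment> \<open>Falsum is added to serve as the least modal formula.\<close>
  define S where "S = insert \<^bold>\<bottom> (sub \<phi>)"
  define v where "v = rank S T"
  have S: "finite S" "sub_closed S" "\<^bold>\<bottom> \<in> S" "\<phi> \<in> S"
    using finite_sub sub_closed_insert_Bot[OF sub_closed_sub] sub_refl by (auto simp: S_def)
  note ctx = S(1-3) T(1) T_Bot
  obtain w0 where w0: "admissible S v 0 w0" "w0 \<phi> < 1"
    using initial_world[OF ctx] S(4) T(2) unfolding v_def by metis
  define I where "I = {\<theta>. \<box>\<theta> \<in> S \<and> v (\<box>\<theta>) < 1}"
  define J where "J = {\<theta>. \<diamond>\<theta> \<in> S \<and> 0 < v (\<diamond>\<theta>)}"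
  have "\<exists>q. admissible S v (fst q) (snd q) \<and> snd q \<theta> < fst q \<and>
      snd q \<theta> \<le> v (\<box>\<theta>) + inverse (Suc n)" if "\<theta> \<in> I" for \<theta> n
    using Box_world[OF ctx] that by (auto simp: v_def I_def)
  then obtain f where f: "\<And>\<theta> n. \<theta> \<in> I \<Longrightarrow> admissible S v (fst (f \<theta> n)) (snd (f \<theta> n)) \<and>
      snd (f \<theta> n) \<theta> < fst (f \<theta> n) \<and> snd (f \<theta> n) \<theta> \<le> v (\<box>\<theta>) + inverse (Suc n)"
    by metis
  have "\<exists>q. admissible S v (fst q) (snd q) \<and> v (\<diamond>\<theta>) \<le> min (fst q) (snd q \<theta>)"
    if "\<theta> \<in> J" for \<theta>
    using Dia_world[OF ctx] that by (auto simp: v_def J_def)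
  then obtain g where g: "\<And>\<theta>. \<theta> \<in> J \<Longrightarrow>
      admissible S v (fst (g \<theta>)) (snd (g \<theta>)) \<and> v (\<diamond>\<theta>) \<le> min (fst (g \<theta>)) (snd (g \<theta>) \<theta>)"
    by metis
  \<comment> \<open>Pairs of possibility and valuation: the refuting world, a sequence of worlds for
    each box and one world for each diamond.\<close>
  define Q where "Q = insert (0, w0) (case_prod f ` (I \<times> UNIV) \<union> g ` J)"
  have "I \<subseteq> S" unfolding I_def using sub_closedD(3)[OF S(2)] by blast
  moreover have "J \<subseteq> S" unfolding J_def using sub_closedD(4)[OF S(2)] by blast
  ultimately have "countable I" "countable J"
    using S(1) countable_finite finite_subset by metis+
  then have Q: "countable Q" by (simp add: Q_def)
  obtain h :: "nat \<Rightarrow> 'w" where h: "inj h" using inf infinite_countable_subset by blast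
  \<comment> \<open>The worlds must be elements of \<open>'w\<close>, so the pairs are enumerated
    and embedded along a sequence of distinct elements.\<close>
  define k where "k = h \<circ> to_nat_on Q"
  have k: "inj_on k Q"
    unfolding k_def using inj_on_to_nat_on[OF Q] h by (metis comp_inj_on inj_on_subset subset_UNIV)
  define W where "W = k ` Q"
  define \<pi> where "\<pi> x = fst (inv_into Q k x)" for x
  define w where "w x = snd (inv_into Q k x)" for x
  have at_k: "k q \<in> W" "\<pi> (k q) = fst q" "w (k q) = snd q" if "q \<in> Q" for q
    using k that by (auto simp: W_def \<pi>_def w_def)
  have Q_adm: "admissible S v (fst q) (snd q)" if "q \<in> Q" for q
    using that f g w0(1) by (auto simp: Q_def)
  have adm: "admissible S v (\<pi> x) (w x)" if "x \<in> W" for x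
    using that Q_adm by (auto simp: W_def at_k)
  have v01: "0 \<le> v \<chi>" "v \<chi> \<le> 1" for \<chi>
    unfolding v_def using rank_nonneg rank_le_1[OF S(1) T(1)] by auto
  have box: "\<exists>x\<in>W. w x \<theta> < \<pi> x \<and> w x \<theta> \<le> v (\<box>\<theta>) + inverse (Suc n)"
    if "\<box>\<theta> \<in> S" "v (\<box>\<theta>) < 1" for \<theta> n
  proof -
    have q: "f \<theta> n \<in> Q" using that by (auto simp: Q_def I_def)
    show ?thesis using at_k[OF q] f[of \<theta> n] that by (intro bexI[of _ "k (f \<theta> n)"]) (auto simp: I_def)
  qed
  have dia: "\<exists>x\<in>W. v (\<diamond>\<theta>) \<le> min (\<pi> x) (w x \<theta>)" if "\<diamond>\<theta> \<in> S" "0 < v (\<diamond>\<theta>)" for \<theta>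
  proof -
    have q: "g \<theta> \<in> Q" using that by (auto simp: Q_def J_def)
    show ?thesis using at_k[OF q] g[of \<theta>] that by (intro bexI[of _ "k (g \<theta>)"]) (auto simp: J_def)
  qed
  have q0: "(0, w0) \<in> Q" by (simp add: Q_def)
  then have "W \<noteq> {}" by (auto simp: W_def)
  have model: "PiG_model W \<pi> (\<lambda>x p. w x (Var p))"
    by (rule eval_admissible(1)[OF S(2) \<open>W \<noteq> {}\<close>]; fact adm v01 box dia)
  have eval: "eval W \<pi> (\<lambda>x p. w x (Var p)) x \<phi> = w x \<phi>" if "x \<in> W" for x
    by (rule eval_admissible(2)[OF S(2) \<open>W \<noteq> {}\<close>]; fact adm v01 box dia S(4) that)
  have "valid_in W \<pi> (\<lambda>x p. w x (Var p)) \<phi>"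
    using valid model by (simp add: PiG_valid_def)
  then have "w (k (0, w0)) \<phi> = 1" using at_k(1)[OF q0] eval by (simp add: valid_in_def)
  then show False using at_k(3)[OF q0] w0(2) by simp
qed

theorem theorem4p1:
  fixes \<phi> :: "'v::countable fm"
  assumes "infinite (UNIV :: 'w set)"
  shows "PiG_valid TYPE('w) \<phi> \<longleftrightarrow> \<turnstile>\<^sub>K\<^sub>4\<^sub>5\<^sub>G \<phi>"
  using completeness[OF assms] soundness by (auto simp: PiG_valid_def valid_in_def)

end
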